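(* Let $M$ be a binary internally $4$-connected matroid in which every element is in exactly three triangles. Then $M$ has at least four elements $e$ such that $\operatorname{si}(M/e)$ is internally $4$-connected. Moreover, if $M$ has fewer than six such elements, then these elements are in a $4$-element cocircuit of $M$.
   Context: For a matroid $M$ with ground set $E$ and rank function $r$, the connectivity function is $\lambda_M(X)=r(X)+r(E-X)-r(M)$ for $X\subseteq E$. For a positive integer $k$, a partition $(X,E-X)$ of $E$ is a $k$-separation if $\lambda_M(X)\le k-1$ and $|X|,|E-X|\ge k$. For an integer $n\ge 2$, $M$ is $n$-connected if it has no $k$-separations for all $k<n$. A triangle is a $3$-element circuit and a triad is a $3$-element cocircuit. $M$ is internally $4$-connected if it is $3$-connected and, for every $3$-separation $(X,Y)$ of $M$, either $X$ or $Y$ is a triangle or a triad of $M$. A matroid is binary if it is representable over the two-element field. $M/e$ denotes the contraction of $e$ from $M$, and $\operatorname{si}(N)$ denotes the simplification of a matroid $N$ (delete all loops and all but one element of each parallel class). *)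

theory Defs
  imports Main "HOL-Library.Z2"
begin

record 'a matroid =
  ground :: "'a set"
  indep :: "'a set \<Rightarrow> bool"

locale matroid =
  fixes M :: "'a matroid" (structure)
  assumes finite_ground: "finite (ground M)"
    and indep_subset_ground: "indep M X \<Longrightarrow> X \<subseteq> ground M"
    and indep_empty: "indep M {}"
    and indep_mono: "indep M Y \<Longrightarrow> X \<subseteq> Y \<Longrightarrow> indep M X"
    and augmentation: "indep M X \<Longrightarrow> indep M Y \<Longrightarrow> card X < card Y
      \<Longrightarrow> \<exists>y\<in>Y - X. indep M (insert y X)"

definition basis :: "'a matroid \<Rightarrow> 'a set \<Rightarrow> bool" where
  "basis M B \<longleftrightarrow> indep M B \<and> (\<forall>X. indep M X \<and> B \<subseteq> X \<longrightarrow> X = B)"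

definition circuit :: "'a matroid \<Rightarrow> 'a set \<Rightarrow> bool" where
  "circuit M C \<longleftrightarrow> C \<subseteq> ground M \<and> \<not> indep M C \<and> (\<forall>X. X \<subset> C \<longrightarrow> indep M X)"

definition matroid_rank :: "'a matroid \<Rightarrow> 'a set \<Rightarrow> nat" where
  "matroid_rank M X = Max (card ` {I. I \<subseteq> X \<and> indep M I})"

text \<open>The bases of the dual are the complements of the bases of \<open>M\<close>.\<close>

definition matroid_dual :: "'a matroid \<Rightarrow> 'a matroid" where
  "matroid_dual M = \<lparr>ground = ground M,
     indep = (\<lambda>I. \<exists>B. basis M B \<and> I \<subseteq> ground M - B)\<rparr>"

definition cocircuit :: "'a matroid \<Rightarrow> 'a set \<Rightarrow> bool" where
  "cocircuit M C \<longleftrightarrow> circuit (matroid_dual M) C"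

definition matroid_restrict :: "'a matroid \<Rightarrow> 'a set \<Rightarrow> 'a matroid" where
  "matroid_restrict M X = \<lparr>ground = ground M \<inter> X, indep = (\<lambda>I. indep M I \<and> I \<subseteq> X)\<rparr>"

definition matroid_delete :: "'a matroid \<Rightarrow> 'a set \<Rightarrow> 'a matroid" where
  "matroid_delete M T = matroid_restrict M (ground M - T)"

definition matroid_contract :: "'a matroid \<Rightarrow> 'a set \<Rightarrow> 'a matroid" where
  "matroid_contract M T = matroid_dual (matroid_delete (matroid_dual M) T)"

definition nonloops :: "'a matroid \<Rightarrow> 'a set" where
  "nonloops M = {e \<in> ground M. \<not> circuit M {e}}"

definition parallel_rel :: "'a matroid \<Rightarrow> ('a \<times> 'a) set" where
  "parallel_rel M = {(e, f). e \<in> nonloops M \<and> f \<in> nonloops M \<and> (e = f \<or> circuit M {e, f})}"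

definition parallel_classes :: "'a matroid \<Rightarrow> 'a set set" where
  "parallel_classes M = nonloops M // parallel_rel M"

text \<open>One representative of each parallel class is kept. Different choices of
  representatives give isomorphic matroids.\<close>

definition simplification :: "'a matroid \<Rightarrow> 'a matroid" where
  "simplification M = matroid_restrict M ((\<lambda>P. SOME e. e \<in> P) ` parallel_classes M)"

text \<open>Integer-valued, to avoid truncated subtraction.\<close>

definition connectivity :: "'a matroid \<Rightarrow> 'a set \<Rightarrow> int" where
  "connectivity M X = int (matroid_rank M X) + int (matroid_rank M (ground M - X))
     - int (matroid_rank M (ground M))"

definition matroid_separation :: "'a matroid \<Rightarrow> nat \<Rightarrow> 'a set \<Rightarrow> 'a set \<Rightarrow> bool" where
  "matroid_separation M k X Y \<longleftrightarrow> 1 \<le> k \<and> X \<union> Y = ground M \<and> X \<inter> Y = {}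
     \<and> connectivity M X \<le> int k - 1 \<and> k \<le> card X \<and> k \<le> card Y"

text \<open>The notion is intended for \<open>n \<ge> 2\<close>.\<close>

definition matroid_connected :: "nat \<Rightarrow> 'a matroid \<Rightarrow> bool" where
  "matroid_connected n M \<longleftrightarrow> (\<forall>k<n. \<not> (\<exists>X Y. matroid_separation M k X Y))"

definition triangle :: "'a matroid \<Rightarrow> 'a set \<Rightarrow> bool" where
  "triangle M T \<longleftrightarrow> circuit M T \<and> card T = 3"

definition triad :: "'a matroid \<Rightarrow> 'a set \<Rightarrow> bool" where
  "triad M T \<longleftrightarrow> cocircuit M T \<and> card T = 3"

definition internally_4_connected :: "'a matroid \<Rightarrow> bool" where
  "internally_4_connected M \<longleftrightarrow> matroid_connected 3 M
     \<and> (\<forall>X Y. matroid_separation M 3 X Y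
          \<longrightarrow> triangle M X \<or> triad M X \<or> triangle M Y \<or> triad M Y)"

text \<open>\<open>A\<close> is a matrix with \<open>m\<close> rows whose columns are labelled by the ground set;
  a set of labels is independent iff the corresponding family of columns is
  linearly independent (so equal columns count with multiplicity).\<close>

definition represents :: "nat \<Rightarrow> (nat \<Rightarrow> 'a \<Rightarrow> 'f::field) \<Rightarrow> 'a matroid \<Rightarrow> bool" where
  "represents m A M \<longleftrightarrow> (\<forall>I\<subseteq>ground M. indep M I \<longleftrightarrow>
     (\<forall>c :: 'a \<Rightarrow> 'f. (\<forall>i<m. (\<Sum>x\<in>I. c x * A i x) = 0) \<longrightarrow> (\<forall>x\<in>I. c x = 0)))"

definition representable :: "'f::field itself \<Rightarrow> 'a matroid \<Rightarrow> bool" where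
  "representable F M \<longleftrightarrow> (\<exists>m (A :: nat \<Rightarrow> 'a \<Rightarrow> 'f). represents m A M)"

definition binary_matroid :: "'a matroid \<Rightarrow> bool" where
  "binary_matroid M \<longleftrightarrow> representable TYPE(bit) M"

end

(*
Represent M by distinct nonzero vectors over GF(2) spanning V. A triangle through a point outside a
subspace has a second point outside it, so M has no small cocircuits and internal 4-connectivity
says that subspaces U, W different from V covering all points satisfy dim U + dim W >= dim V + 3.
If the contraction si(M/e) fails to be internally 4-connected, then e lies in U Int W for such a
cover attaining equality, a vertical 4-separation.

Take one with dim U minimal and suppose a point x outside W lies in U1 Int W1 for another
separation (U1, W1). Uncrossing shows that U Int U1 and U Int W1 have dimension at most 3. Some
point outside W and W1 has all its three triangles inside U Int U1, which is thus a Fano plane of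
points; likewise U Int W1. Then x is in too many triangles. So all points outside W have internally
4-connected contractions. If there are fewer than six of them, they are on one side of every
separation, and a second minimal choice yields at least four more. Hence there are always at least
six, and the case of fewer than six elements is void.
*)
theory Submission
  imports Defs "HOL-Library.Function_Algebras"
begin

section \<open>Finite subspaces over the two-element field\<close>

lemma bitvec_add_self [simp]: "(x :: 'i \<Rightarrow> bit) + x = 0"
  by (rule ext) simp

lemma bitvec_add_cancel [simp]: "(x :: 'i \<Rightarrow> bit) + (x + y) = y"
  by (simp flip: add.assoc)

lemma bitvec_add_eq_0_iff: "(x :: 'i \<Rightarrow> bit) + y = 0 \<longleftrightarrow> x = y"
  by (metis add.right_neutral bitvec_add_cancel bitvec_add_self)

lemma bitvec_add_eq_iff: "(x :: 'i \<Rightarrow> bit) + y = z \<longleftrightarrow> y = x + z"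
  by (metis bitvec_add_cancel)

text \<open>Over GF(2) a set containing 0 and closed under addition is a linear subspace. Finiteness
  is included so that the dimension can be read off from the cardinality.\<close>

definition bspace :: "('i \<Rightarrow> bit) set \<Rightarrow> bool" where
  "bspace S \<longleftrightarrow> finite S \<and> 0 \<in> S \<and> (\<forall>x\<in>S. \<forall>y\<in>S. x + y \<in> S)"

text \<open>A space of dimension n over GF(2) has 2^n elements; this defines the dimension without
  choosing bases.\<close>

definition bdim :: "('i \<Rightarrow> bit) set \<Rightarrow> nat" where
  "bdim S = (THE n. card S = 2 ^ n)"

definition bsum :: "('i \<Rightarrow> bit) set \<Rightarrow> ('i \<Rightarrow> bit) set \<Rightarrow> ('i \<Rightarrow> bit) set" where
  "bsum A B = (\<lambda>(a, b). a + b) ` (A \<times> B)"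

lemma bspace_finite: "bspace S \<Longrightarrow> finite S"
  and bspace_0: "bspace S \<Longrightarrow> 0 \<in> S"
  and bspace_add: "bspace S \<Longrightarrow> x \<in> S \<Longrightarrow> y \<in> S \<Longrightarrow> x + y \<in> S"
  by (auto simp: bspace_def)

lemma bspace_add_iff: "bspace S \<Longrightarrow> x \<in> S \<Longrightarrow> x + y \<in> S \<longleftrightarrow> y \<in> S"
  by (metis bitvec_add_cancel bspace_add)

lemma bspace_add_iff2: "bspace S \<Longrightarrow> y \<in> S \<Longrightarrow> x + y \<in> S \<longleftrightarrow> x \<in> S"
  by (metis add.commute bspace_add_iff)

lemma bspace_Int: "bspace A \<Longrightarrow> bspace B \<Longrightarrow> bspace (A \<inter> B)"
  by (auto simp: bspace_def)

lemma bspace_adjoin: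
  assumes "bspace S"
  shows "bspace (S \<union> (+) x ` S)"
proof -
  \<comment> \<open>Since \<open>x + x = 0\<close>, the coset \<open>x + S\<close> consists of the
    \<open>c\<close> with \<open>x + c\<close> in \<open>S\<close>. In this symmetric form closure
    under addition splits into four easy cases.\<close>
  have iff: "c \<in> S \<union> (+) x ` S \<longleftrightarrow> c \<in> S \<or> x + c \<in> S" for c
  proof
    assume "c \<in> S \<or> x + c \<in> S"
    moreover have "c = x + (x + c)" by simp
    ultimately show "c \<in> S \<union> (+) x ` S" by blast
  next
    assume "c \<in> S \<union> (+) x ` S"
    then show "c \<in> S \<or> x + c \<in> S"
      by (elim UnE imageE) simp_all
  qed
  have "a + b \<in> S \<or> x + (a + b) \<in> S" if "a \<in> S \<or> x + a \<in> S" "b \<in> S \<or> x + b \<in> S" for a b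
  proof -
    have eqs: "x + a + b = x + (a + b)" "a + (x + b) = x + (a + b)" "(x + a) + (x + b) = a + b"
      by (simp_all only: add.assoc add.left_commute[of a x] bitvec_add_cancel)
    note closed = bspace_add[OF assms, of a b] bspace_add[OF assms, of "x + a" b]
      bspace_add[OF assms, of a "x + b"] bspace_add[OF assms, of "x + a" "x + b"]
    from that closed[unfolded eqs] show ?thesis by blast
  qed
  with assms show ?thesis
    unfolding bspace_def Ball_def iff by (simp only: finite_Un finite_imageI simp_thms) blast
qed

lemma card_bspace_adjoin:
  assumes "bspace S" "x \<notin> S"
  shows "card (S \<union> (+) x ` S) = 2 * card S"
proof -
  have "x + y \<notin> S" if "y \<in> S" for y
    using assms that by (simp add: bspace_add_iff2)
  then have "S \<inter> (+) x ` S = {}"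
    by blast
  moreover have "card ((+) x ` S) = card S"
    by (intro card_image inj_onI) (simp only: add_left_cancel)
  ultimately show ?thesis
    using assms by (simp add: card_Un_disjoint bspace_finite)
qed

text \<open>Subspaces grow from \<open>{0}\<close> by adjoining one point at a time, and each step
  doubles the cardinality. A largest subspace of \<open>S\<close> whose cardinality is a power of
  two is therefore \<open>S\<close> itself.\<close>

lemma card_bspace_ex:
  assumes "bspace S"
  shows "\<exists>n. card S = 2 ^ n"
proof -
  define P where "P T \<longleftrightarrow> bspace T \<and> T \<subseteq> S \<and> (\<exists>n. card T = 2 ^ n)" for T
  have "P {0}"
    using assms by (auto simp: P_def bspace_def intro!: exI[of _ 0])
  moreover have "\<forall>T. P T \<longrightarrow> card T < Suc (card S)"
    using assms by (simp add: P_def less_Suc_eq_le card_mono bspace_finite)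
  ultimately have "\<exists>T. P T \<and> (\<forall>T'. P T' \<longrightarrow> card T' \<le> card T)"
    by (rule ex_has_greatest_nat)
  then obtain T where T: "bspace T" "T \<subseteq> S" "\<exists>n. card T = 2 ^ n"
    and max: "\<And>T'. P T' \<Longrightarrow> card T' \<le> card T"
    unfolding P_def by blast
  then obtain n where n: "card T = 2 ^ n" by blast
  have "T = S"
  proof (rule ccontr)
    assume "T \<noteq> S"
    then obtain x where x: "x \<in> S" "x \<notin> T" using T by blast
    have "T \<union> (+) x ` T \<subseteq> S"
      using T x assms by (auto intro: bspace_add)
    moreover have "card (T \<union> (+) x ` T) = 2 ^ Suc n"
      using card_bspace_adjoin[OF T(1) x(2)] n by simp
    ultimately have "card (T \<union> (+) x ` T) \<le> card T"
      using bspace_adjoin[OF T(1), of x] by (intro max) (unfold P_def, blast)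
    then show False
      using n \<open>card (T \<union> (+) x ` T) = 2 ^ Suc n\<close> by simp
  qed
  then show ?thesis using n by blast
qed

lemma bdimI: "card S = 2 ^ n \<Longrightarrow> bdim S = n"
  unfolding bdim_def by (rule the_equality) auto

lemma card_bspace: "bspace S \<Longrightarrow> card S = 2 ^ bdim S"
  using card_bspace_ex[of S] bdimI[of S] by auto

lemma bdim_mono:
  assumes "bspace A" "bspace B" "A \<subseteq> B"
  shows "bdim A \<le> bdim B"
proof -
  have "(2::nat) ^ bdim A \<le> 2 ^ bdim B"
    using assms card_mono[of B A] by (simp only: bspace_finite flip: card_bspace)
  then show ?thesis by simp
qed

lemma bdim_eq:
  assumes "bspace A" "bspace B" "A \<subseteq> B" "bdim B \<le> bdim A"
  shows "A = B"
proof -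
  have "card B = card A"
    using assms bdim_mono[of A B] by (simp add: card_bspace)
  then show ?thesis
    using assms card_subset_eq[of B A] by (simp add: bspace_finite)
qed

lemma bdim_less:
  assumes "bspace A" "bspace B" "A \<subset> B"
  shows "bdim A < bdim B"
  using assms bdim_eq[of A B] by force

lemma bsumI: "a \<in> A \<Longrightarrow> b \<in> B \<Longrightarrow> a + b \<in> bsum A B"
  by (auto simp: bsum_def)

lemma bsumE:
  assumes "c \<in> bsum A B"
  obtains a b where "a \<in> A" "b \<in> B" "c = a + b"
  using assms by (auto simp: bsum_def)

lemma bspace_bsum:
  assumes "bspace A" "bspace B"
  shows "bspace (bsum A B)"
  unfolding bspace_def
proof (intro conjI ballI)
  show "finite (bsum A B)"
    using assms by (simp add: bsum_def bspace_finite)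
  show "0 \<in> bsum A B"
    using bsumI[OF bspace_0 bspace_0, OF assms] by simp
  fix x y assume "x \<in> bsum A B" "y \<in> bsum A B"
  then obtain a b c d where *: "a \<in> A" "b \<in> B" "x = a + b" "c \<in> A" "d \<in> B" "y = c + d"
    by (meson bsumE)
  have "x + y = (a + c) + (b + d)"
    unfolding * by (simp only: add.assoc add.left_commute[of b c])
  moreover have "(a + c) + (b + d) \<in> bsum A B"
    using * assms by (intro bsumI bspace_add)
  ultimately show "x + y \<in> bsum A B" by simp
qed

lemma bsum_upper1: "bspace B \<Longrightarrow> A \<subseteq> bsum A B"
  using bsumI[OF _ bspace_0, of _ A B] by auto

lemma bsum_upper2: "bspace A \<Longrightarrow> B \<subseteq> bsum A B"
  using bsumI[OF bspace_0, of A _ B] by auto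

lemma bsum_least:
  assumes "bspace C" "A \<subseteq> C" "B \<subseteq> C"
  shows "bsum A B \<subseteq> C"
proof
  fix c assume "c \<in> bsum A B"
  then obtain a b where "a \<in> A" "b \<in> B" "c = a + b" by (rule bsumE)
  then show "c \<in> C" using assms bspace_add by blast
qed

text \<open>Count the pairs in the product of \<open>A\<close> and \<open>B\<close> by their sum:
  the pairs with the same sum as \<open>(a0, b0)\<close> are the \<open>(a0 + t, b0 + t)\<close>
  with \<open>t\<close> in \<open>A \<inter> B\<close>, so all fibres have the same size.\<close>

lemma bdim_bsum:
  assumes A: "bspace A" and B: "bspace B"
  shows "bdim (A \<inter> B) + bdim (bsum A B) = bdim A + bdim B"
proof -
  have fin: "finite A" "finite B" using assms by (auto simp: bspace_finite)
  have fibre: "card {p \<in> A \<times> B. (case p of (a, b) \<Rightarrow> a + b) = c} = card (A \<inter> B)"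
    if c_in: "c \<in> bsum A B" for c
  proof -
    obtain a0 b0 where c: "c = a0 + b0" "a0 \<in> A" "b0 \<in> B"
      using c_in bsumE by metis
    have rest: "(a0 + t, b0 + t) \<in> A \<times> B" "(a0 + t) + (b0 + t) = c" if "t \<in> A \<inter> B" for t
    proof -
      show "(a0 + t, b0 + t) \<in> A \<times> B"
        using that c A B by (simp add: bspace_add)
      show "(a0 + t) + (b0 + t) = c"
        by (simp only: c add.assoc add.left_commute[of t b0] bitvec_add_self add.right_neutral)
    qed
    have other: "b = b0 + (a0 + a)" if "a + b = c" for a b
    proof -
      have "b = a + c" using that by (simp add: bitvec_add_eq_iff)
      then show ?thesis by (simp only: c add.commute[of a] add.assoc add.left_commute[of b0 a0])
    qed
    have "bij_betw (\<lambda>t. (a0 + t, b0 + t)) (A \<inter> B) {p \<in> A \<times> B. (case p of (a, b) \<Rightarrow> a + b) = c}"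
    proof (rule bij_betw_byWitness[where f' = "\<lambda>p. a0 + fst p"])
      show "(\<lambda>t. (a0 + t, b0 + t)) ` (A \<inter> B) \<subseteq> {p \<in> A \<times> B. (case p of (a, b) \<Rightarrow> a + b) = c}"
        using rest by auto
      have "a0 + a \<in> A \<inter> B" if "a \<in> A" "b \<in> B" "a + b = c" for a b
        using other[OF that(3)] that(1,2) A B c(2,3) by (simp add: bspace_add bspace_add_iff)
      then show "(\<lambda>p. a0 + fst p) ` {p \<in> A \<times> B. (case p of (a, b) \<Rightarrow> a + b) = c} \<subseteq> A \<inter> B"
        by auto
      show "\<forall>p\<in>{p \<in> A \<times> B. (case p of (a, b) \<Rightarrow> a + b) = c}. (a0 + (a0 + fst p), b0 + (a0 + fst p)) = p"
        using other by auto
    qed simp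
    then show ?thesis by (simp add: bij_betw_same_card)
  qed
  have "card A * card B = (\<Sum>p\<in>A \<times> B. 1)"
    by (simp add: card_cartesian_product)
  also have "\<dots> = (\<Sum>c\<in>bsum A B. \<Sum>p | p \<in> A \<times> B \<and> (case p of (a, b) \<Rightarrow> a + b) = c. 1)"
    unfolding bsum_def using fin by (intro sum.image_gen) auto
  also have "\<dots> = card (bsum A B) * card (A \<inter> B)"
    using fibre by simp
  finally have "(2::nat) ^ (bdim A + bdim B) = 2 ^ (bdim (A \<inter> B) + bdim (bsum A B))"
    using A B by (simp add: card_bspace bspace_Int bspace_bsum power_add mult.commute)
  then show ?thesis by simp
qed

section \<open>Point sets with three triangles at each point\<close>

text \<open>The other points of the lines \<open>{e, a, e + a}\<close> inside \<open>E\<close>. A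
  triangle through \<open>e\<close> contributes both of its other points, so three triangles give
  six neighbours.\<close>

definition nbrs :: "('i \<Rightarrow> bit) set \<Rightarrow> ('i \<Rightarrow> bit) \<Rightarrow> ('i \<Rightarrow> bit) set" where
  "nbrs E e = {a \<in> E. e + a \<in> E}"

text \<open>If two points of a line lie in \<open>S\<close>, so does the third. Hence adding
  \<open>x\<close> maps the neighbours inside \<open>S\<close> injectively to neighbours outside, so
  at least three of the six are outside, and \<open>x\<close> itself is the fourth. In matroid
  terms, cocircuits have at least four elements.\<close>

lemma card_outside_bspace_ge_4:
  assumes "finite E" "0 \<notin> E" "bspace S" "x \<in> E" "x \<notin> S" "card (nbrs E x) = 6"
  shows "4 \<le> card (E - S)"
proof -
  have fin: "finite (nbrs E x)" using assms(1) by (simp add: nbrs_def)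
  have "(+) x ` (nbrs E x \<inter> S) \<subseteq> nbrs E x - S"
    using assms(3,5) by (auto simp: nbrs_def bspace_add_iff2)
  then have "card ((+) x ` (nbrs E x \<inter> S)) \<le> card (nbrs E x - S)"
    using fin by (intro card_mono) auto
  moreover have "card ((+) x ` (nbrs E x \<inter> S)) = card (nbrs E x \<inter> S)"
    by (intro card_image inj_onI) simp
  moreover have "card (nbrs E x \<inter> S) + card (nbrs E x - S) = 6"
    using fin assms(6) by (metis card_Int_Diff)
  ultimately have "3 \<le> card (nbrs E x - S)" by linarith
  moreover have "x \<notin> nbrs E x" using assms(2) by (simp add: nbrs_def)
  ultimately have "4 \<le> card (insert x (nbrs E x - S))"
    using fin by simp
  also have "\<dots> \<le> card (E - S)"
    using assms(1,4,5) by (intro card_mono) (auto simp: nbrs_def)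
  finally show ?thesis .
qed

text \<open>\<open>V\<close> is the span of \<open>E\<close>. Condition \<open>conn\<close> is
  internal 4-connectivity for the spans of two sides: the exceptional triangles and triads cannot
  occur, as at least four points avoid any subspace not containing \<open>E\<close>.\<close>

locale three_triangle_points =
  fixes E V :: "('i \<Rightarrow> bit) set"
  assumes V: "bspace V" and E_V: "E \<subseteq> V"
    and V_least: "bspace S \<Longrightarrow> E \<subseteq> S \<Longrightarrow> V \<subseteq> S"
    and zero: "0 \<notin> E" and nonempty: "E \<noteq> {}"
    and card_nbrs: "e \<in> E \<Longrightarrow> card (nbrs E e) = 6"
    and conn: "bspace U \<Longrightarrow> bspace W \<Longrightarrow> U \<subseteq> V \<Longrightarrow> W \<subseteq> V \<Longrightarrow> E \<subseteq> U \<union> W \<Longrightarrow>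
      \<not> E \<subseteq> U \<Longrightarrow> \<not> E \<subseteq> W \<Longrightarrow> bdim V + 3 \<le> bdim U + bdim W"
begin

section \<open>Vertical 4-separations and uncrossing\<close>

definition vsep :: "('i \<Rightarrow> bit) set \<Rightarrow> ('i \<Rightarrow> bit) set \<Rightarrow> bool" where
  "vsep U W \<longleftrightarrow> bspace U \<and> bspace W \<and> U \<subseteq> V \<and> W \<subseteq> V \<and> E \<subseteq> U \<union> W
     \<and> \<not> E \<subseteq> U \<and> \<not> E \<subseteq> W \<and> bdim U + bdim W = bdim V + 3"

text \<open>Dividing out a point \<open>e\<close> of \<open>U \<inter> W\<close> lowers the
  dimensions of \<open>U\<close>, \<open>W\<close> and \<open>V\<close> by one each, so a
  \<open>vsep\<close> pair through \<open>e\<close> leaves connectivity 2 in the contraction. Points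
  on both sides are the ones in danger, hence covers rather than partitions.\<close>

definition good :: "('i \<Rightarrow> bit) \<Rightarrow> bool" where
  "good e \<longleftrightarrow> (\<forall>U W. vsep U W \<longrightarrow> e \<notin> U \<inter> W)"

lemma finite_E: "finite E"
  using E_V V bspace_finite finite_subset by blast

lemma vsep_commute: "vsep U W \<longleftrightarrow> vsep W U"
  by (auto simp: vsep_def)

lemma vsepD:
  assumes "vsep U W"
  shows "bspace U" "bspace W" "U \<subseteq> V" "W \<subseteq> V" "E \<subseteq> U \<union> W" "\<not> E \<subseteq> U" "\<not> E \<subseteq> W"
    "bdim U + bdim W = bdim V + 3"
  using assms by (auto simp: vsep_def)

text \<open>If \<open>b\<close> were outside \<open>U\<close>, then so would be
  \<open>a + b\<close>, because \<open>a\<close> is in \<open>U\<close>. Both would lie in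
  \<open>W\<close>, and then so would their sum \<open>a\<close>.\<close>

lemma no_crossing:
  assumes "bspace U" "bspace W" "E \<subseteq> U \<union> W" "a \<in> E" "a \<notin> W" "b \<in> nbrs E a"
  shows "b \<in> U"
proof -
  have "a \<in> U" "b \<in> E" "a + b \<in> E" using assms by (auto simp: nbrs_def)
  then show ?thesis
    using assms bspace_add_iff[of U a b] bspace_add_iff2[of W b a] by blast
qed

lemma not_E_subset: "bspace S \<Longrightarrow> S \<subseteq> V \<Longrightarrow> S \<noteq> V \<Longrightarrow> \<not> E \<subseteq> S"
  using V_least by blast

lemma vsep_card_side:
  assumes "vsep U W"
  shows "4 \<le> card (E - W)"
proof -
  obtain x where "x \<in> E" "x \<notin> W" using assms by (auto simp: vsep_def)
  then show ?thesis
    using card_outside_bspace_ge_4 finite_E zero vsepD(2)[OF assms] card_nbrs by blast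
qed

text \<open>Uncrossing: the dimensions of the covers \<open>(U \<inter> U1, W + W1)\<close> and \<open>(W \<inter> W1, U + U1)\<close>
  add up to \<open>2 (bdim V + 3)\<close>. Minimality of \<open>U\<close> excludes that the first is again a separation, so
  the second is too small to be a pair of proper subspaces.\<close>

lemma uncross:
  assumes sep: "vsep U W" and sep1: "vsep U1 W1"
    and x: "x \<in> W1" "x \<notin> W"
    and min: "\<And>U' W'. vsep U' W' \<Longrightarrow> W \<subseteq> W' \<Longrightarrow> bdim U \<le> bdim U'"
    and ne: "bsum W W1 \<noteq> V"
  shows "bdim (W \<inter> W1) \<le> 2" "bdim W1 + 2 \<le> bdim U"
proof -
  note s = vsepD[OF sep] and s1 = vsepD[OF sep1]
  let ?A = "U \<inter> U1" and ?B = "bsum W W1" and ?C = "bsum U U1" and ?D = "W \<inter> W1"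
  have sp: "bspace ?A" "bspace ?B" "bspace ?C" "bspace ?D"
    using s s1 by (simp_all add: bspace_Int bspace_bsum)
  have up: "W \<subseteq> ?B" "W1 \<subseteq> ?B" "U \<subseteq> ?C" "U1 \<subseteq> ?C"
    using s s1 by (simp_all add: bsum_upper1 bsum_upper2)
  have sub: "?A \<subseteq> V" "?B \<subseteq> V" "?C \<subseteq> V" "?D \<subseteq> V"
    using s s1 V by (simp_all add: bsum_least le_infI1)
  have total: "bdim ?A + bdim ?C = bdim U + bdim U1" "bdim ?D + bdim ?B = bdim W + bdim W1"
    using s s1 by (simp_all add: bdim_bsum)
  have cover: "E \<subseteq> ?A \<union> ?B" "E \<subseteq> ?D \<union> ?C"
    using s(5) s1(5) up by blast+
  have proper: "\<not> E \<subseteq> ?A" "\<not> E \<subseteq> ?B" "\<not> E \<subseteq> ?D"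
    using s(6,7) not_E_subset[OF sp(2) sub(2) ne] by auto
  have AB: "bdim V + 3 \<le> bdim ?A + bdim ?B"
    using conn sp sub cover proper by blast
  have "bdim ?A + bdim ?B \<noteq> bdim V + 3"
  proof
    assume eq: "bdim ?A + bdim ?B = bdim V + 3"
    then have "vsep ?A ?B" using sp sub cover proper by (simp add: vsep_def)
    \<comment> \<open>\<open>min\<close> applies because \<open>W\<close> is contained in
      \<open>?B\<close>. It forces \<open>?B = W\<close>, but \<open>x\<close> lies in
      \<open>?B\<close> and not in \<open>W\<close>.\<close>
    then have "bdim U \<le> bdim ?A" using min up by blast
    then have "bdim ?B \<le> bdim W" using eq s(8) by linarith
    then have "W = ?B" using bdim_eq s sp up by blast
    then show False using x up by blast
  qed
  then have small: "bdim ?D + bdim ?C < bdim V + 3"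
    using AB total s(8) s1(8) by linarith
  have "?C = V"
  proof (rule ccontr)
    assume "?C \<noteq> V"
    then have "\<not> E \<subseteq> ?C" using not_E_subset sp sub by blast
    then show False using conn[of ?D ?C] sp sub cover proper small by simp
  qed
  then show D: "bdim ?D \<le> 2" using small by simp
  have "bdim ?B < bdim V" using bdim_less sp V sub ne by blast
  then show "bdim W1 + 2 \<le> bdim U"
    using D total s(8) by linarith
qed

text \<open>As \<open>W + W1\<close> is all of \<open>V\<close>, the dimensions of
  \<open>U \<inter> U1\<close>, \<open>U + U1\<close> and \<open>W \<inter> W1\<close> add up to
  \<open>bdim V + 6\<close>. If \<open>U + U1\<close> is proper, \<open>conn\<close> for the cover
  by \<open>W \<inter> W1\<close> and \<open>U + U1\<close> takes at least \<open>bdim V + 3\<close>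
  of this. If it is \<open>V\<close>, hypothesis \<open>U1\<close> gives the bound instead.\<close>

lemma uncross_dim:
  assumes sep: "vsep U W" and sep1: "vsep U1 W1"
    and W: "bsum W W1 = V" and U1: "bdim U \<le> bdim W1"
  shows "bdim (U \<inter> U1) \<le> 3"
proof -
  note s = vsepD[OF sep] and s1 = vsepD[OF sep1]
  let ?A = "U \<inter> U1" and ?C = "bsum U U1" and ?D = "W \<inter> W1"
  have sp: "bspace ?C" "bspace ?D"
    using s s1 by (simp_all add: bspace_Int bspace_bsum)
  have up: "U \<subseteq> ?C" "U1 \<subseteq> ?C"
    using s s1 by (simp_all add: bsum_upper1 bsum_upper2)
  have sub: "?C \<subseteq> V" "?D \<subseteq> V"
    using s s1 V by (simp_all add: bsum_least le_infI1)
  have total: "bdim ?A + bdim ?C = bdim U + bdim U1" "bdim ?D + bdim V = bdim W + bdim W1"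
    using s s1 bdim_bsum[of W W1] W by (simp_all add: bdim_bsum)
  show ?thesis
  proof (cases "?C = V")
    case True
    then show ?thesis using total(1)[unfolded True] s(8) s1(8) U1 by linarith
  next
    case False
    then have "bdim V + 3 \<le> bdim ?D + bdim ?C"
      using conn[of ?D ?C] sp sub s(5,7) s1(5) up not_E_subset by blast
    then show ?thesis using total s(8) s1(8) by linarith
  qed
qed

text \<open>If \<open>U1\<close> contained all points outside \<open>W\<close>, then
  \<open>U1\<close> and \<open>W \<inter> W1\<close> would still cover \<open>E\<close>. As
  \<open>x\<close> is in \<open>W1\<close> but not in \<open>W\<close>, this intersection has
  smaller dimension than \<open>W1\<close>, and the cover violates \<open>conn\<close>.\<close>

lemma side_not_subset:
  assumes sep: "vsep U W" and sep1: "vsep U1 W1" and x: "x \<in> W1" "x \<notin> W"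
  shows "\<exists>y\<in>E - W. y \<notin> U1"
proof (rule ccontr)
  assume "\<not> ?thesis"
  then have sub: "E - W \<subseteq> U1" by blast
  note s = vsepD[OF sep] and s1 = vsepD[OF sep1]
  have "bdim V + 3 \<le> bdim U1 + bdim (W \<inter> W1)"
    using s s1 sub by (intro conn) (auto simp: bspace_Int)
  moreover have "bdim (W \<inter> W1) < bdim W1"
    using s s1 x by (intro bdim_less) (auto simp: bspace_Int)
  ultimately show False using s1(8) by linarith
qed

text \<open>The point \<open>y\<close>, its six neighbours and \<open>0\<close> already exhaust the at most eight elements of \<open>A\<close>.\<close>

lemma Fano_plane:
  assumes "bspace A" "bdim A \<le> 3" "y \<in> E" "y \<in> A" "nbrs E y \<subseteq> A"
  shows "card A = 8" "A - {0} \<subseteq> E"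
proof -
  have fin: "finite A" using assms bspace_finite by blast
  have "y \<noteq> 0" using assms zero by blast
  have sub: "nbrs E y \<subseteq> A - {0, y}"
    using assms zero by (auto simp: nbrs_def)
  have "card A \<le> 2 ^ 3"
    unfolding card_bspace[OF assms(1)] using assms(2) by (intro power_increasing) auto
  moreover have two: "card (A - {0, y}) = card A - 2"
    using assms \<open>y \<noteq> 0\<close> bspace_0 fin by (subst card_Diff_subset) auto
  moreover have le: "6 \<le> card (A - {0, y})"
    using card_mono[OF _ sub] fin card_nbrs[OF assms(3)] by simp
  ultimately show "card A = 8" by simp
  then have "nbrs E y = A - {0, y}"
    using sub two fin card_nbrs[OF assms(3)] by (intro card_subset_eq) auto
  then show "A - {0} \<subseteq> E" using assms(3) by (auto simp: nbrs_def)
qed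

text \<open>Minimality is required only against separations with \<open>W\<close> inside
  \<open>W'\<close>, so that the argument serves both for a global minimum and for a minimum among
  separations keeping a given set on one side. The bounds \<open>dims\<close> hold in the two uses
  for different reasons.\<close>

lemma minimal_side_good:
  assumes sep: "vsep U W" and sep1: "vsep U1 W1"
    and x: "x \<in> E" "x \<notin> W" "x \<in> U1" "x \<in> W1"
    and min: "\<And>U' W'. vsep U' W' \<Longrightarrow> W \<subseteq> W' \<Longrightarrow> bdim U \<le> bdim U'"
    and dims: "bdim U \<le> bdim U1" "bdim U \<le> bdim W1"
  shows False
proof -
  note s = vsepD[OF sep] and s1 = vsepD[OF sep1]
  have sep1': "vsep W1 U1" using sep1 vsep_commute by blast
  have "bsum W W1 = V"
    using uncross(2)[OF sep sep1 x(4,2) min] dims by fastforce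
  then have A3: "bdim (U \<inter> U1) \<le> 3" using uncross_dim sep sep1 dims by blast
  have "bsum W U1 = V"
    using uncross(2)[OF sep sep1' x(3,2) min] dims by fastforce
  then have B3: "bdim (U \<inter> W1) \<le> 3" using uncross_dim sep sep1' dims by blast
  let ?A = "U \<inter> U1" and ?B = "U \<inter> W1"
  have sp: "bspace ?A" "bspace ?B" "bspace (?A \<inter> ?B)" using s s1 by (simp_all add: bspace_Int)
  obtain y where y: "y \<in> E" "y \<notin> W" "y \<notin> W1"
    using side_not_subset[OF sep sep1' x(3,2)] by blast
  obtain z where z: "z \<in> E" "z \<notin> W" "z \<notin> U1"
    using side_not_subset[OF sep sep1 x(4,2)] by blast
  have "nbrs E y \<subseteq> ?A"
    using no_crossing[of U W y] no_crossing[of U1 W1 y] s s1 y by blast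
  moreover have y_in: "y \<in> ?A" using y s(5) s1(5) by blast
  ultimately have A: "card ?A = 8" "?A - {0} \<subseteq> E"
    using Fano_plane[OF sp(1) A3 y(1)] by blast+
  have "nbrs E z \<subseteq> ?B"
    using no_crossing[of U W z] no_crossing[of W1 U1 z] s s1 z by blast
  moreover have z_in: "z \<in> ?B" using z s(5) s1(5) by blast
  ultimately have B: "card ?B = 8" "?B - {0} \<subseteq> E"
    using Fano_plane[OF sp(2) B3 z(1)] by blast+
  have x_in: "x \<in> ?A" "x \<in> ?B" using x s(5) by auto
  have fin: "finite ?A" "finite ?B" using sp bspace_finite by blast+
  \<comment> \<open>The planes differ, since \<open>y\<close> is not in \<open>W1\<close>. They
    share at most four of their eight elements, so the union has at least 8 + 8 - 4 = 12.\<close>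
  have "bdim (?A \<inter> ?B) < bdim ?A"
    using sp y_in y by (intro bdim_less) auto
  then have "card (?A \<inter> ?B) \<le> 2 ^ 2"
    unfolding card_bspace[OF sp(3)] using A3 by (intro power_increasing) auto
  then have "12 \<le> card (?A \<union> ?B)"
    using card_Un_Int[OF fin] A B by simp
  \<comment> \<open>Dropping \<open>0\<close> and \<open>x\<close> leaves at least ten elements, all
    of them neighbours of \<open>x\<close>: the third point of the line through \<open>x\<close>
    stays in the same plane.\<close>
  then have "10 \<le> card (?A \<union> ?B - {0, x})"
    using diff_card_le_card_Diff[of "{0, x}" "?A \<union> ?B"] card_insert_le_m1[of 2 "{x}" 0] by simp
  moreover have "?A \<union> ?B - {0, x} \<subseteq> nbrs E x"
  proof
    fix a assume a: "a \<in> ?A \<union> ?B - {0, x}"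
    then have "x + a \<noteq> 0" by (auto simp: bitvec_add_eq_0_iff)
    moreover have "x + a \<in> ?A \<union> ?B" using a x_in sp bspace_add by blast
    ultimately show "a \<in> nbrs E x" using a A B by (auto simp: nbrs_def)
  qed
  ultimately show False
    using card_mono[of "nbrs E x" "?A \<union> ?B - {0, x}"] card_nbrs[OF x(1)] finite_E
    by (simp add: nbrs_def)
qed

text \<open>Each triangle through a point of \<open>E - W\<close> has a second point there, so a good side that is
  split by another separation has at least four points on either side.\<close>

lemma good_side_unsplit:
  assumes sep: "vsep U W" and sep1: "vsep U1 W1"
    and good: "\<And>x. x \<in> E - W \<Longrightarrow> good x" and small: "card (E - W) < 8"
  shows "E - W \<subseteq> U1 \<or> E - W \<subseteq> W1"
proof (rule ccontr)
  assume "\<not> ?thesis"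
  then obtain y z where yz: "y \<in> E - W" "y \<notin> W1" "z \<in> E - W" "z \<notin> U1" by blast
  note s = vsepD[OF sep] and s1 = vsepD[OF sep1]
  have excl: "x \<notin> U1 \<or> x \<notin> W1" if "x \<in> E - W" for x
    using good[OF that] sep1 by (auto simp: good_def)
  have four: "4 \<le> card ((E - W) - W2)"
    if W2: "bspace U2" "bspace W2" "E \<subseteq> U2 \<union> W2" and y: "y \<in> E - W" "y \<notin> W2"
      and ex: "\<And>x. x \<in> E - W \<Longrightarrow> x \<notin> U2 \<or> x \<notin> W2" for U2 W2 y
  proof -
    \<comment> \<open>The count is applied to \<open>y\<close> with its six neighbours in place of
      \<open>E\<close>, since these are known to stay in \<open>U2\<close>. Those outside
      \<open>W\<close> then avoid \<open>W2\<close> by \<open>ex\<close>.\<close>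
    have "4 \<le> card (insert y (nbrs E y) - W)"
    proof -
      have "nbrs (insert y (nbrs E y)) y = nbrs E y"
        using y zero by (auto simp: nbrs_def)
      then show ?thesis
        using y zero finite_E s(2) card_nbrs
        by (intro card_outside_bspace_ge_4[where x = y]) (auto simp: nbrs_def)
    qed
    also have "\<dots> \<le> card ((E - W) - W2)"
    proof (intro card_mono)
      show "insert y (nbrs E y) - W \<subseteq> (E - W) - W2"
        using no_crossing[OF W2, of y] y ex by (auto simp: nbrs_def)
    qed (use finite_E in simp)
    finally show ?thesis .
  qed
  have "4 \<le> card ((E - W) - W1)" "4 \<le> card ((E - W) - U1)"
    using four[of U1 W1 y] four[of W1 U1 z] s1 yz excl by blast+
  moreover have "card ((E - W) - W1) + card ((E - W) - U1) \<le> card (E - W)"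
  proof -
    have "((E - W) - W1) \<inter> ((E - W) - U1) = {}" using s1(5) by blast
    then have "card ((E - W) - W1) + card ((E - W) - U1) = card (((E - W) - W1) \<union> ((E - W) - U1))"
      using finite_E by (simp add: card_Un_disjoint)
    also have "\<dots> \<le> card (E - W)" using finite_E by (intro card_mono) auto
    finally show ?thesis .
  qed
  ultimately show False using small by linarith
qed

section \<open>Counting the good points\<close>

lemma minimal_vsep:
  assumes "vsep U0 W0" "Q W0"
  obtains U W where "vsep U W" "Q W" "\<And>U' W'. vsep U' W' \<Longrightarrow> Q W' \<Longrightarrow> bdim U \<le> bdim U'"
proof -
  let ?P = "\<lambda>p. vsep (fst p) (snd p) \<and> Q (snd p)"
  have "\<exists>p. ?P p \<and> (\<forall>p'. ?P p' \<longrightarrow> bdim (fst p) \<le> bdim (fst p'))"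
    using assms by (intro ex_has_least_nat[of ?P "(U0, W0)"]) simp
  then show thesis using that by auto
qed

theorem six_le_card_good: "6 \<le> card {e \<in> E. good e}"
proof (cases "\<exists>U W. vsep U W")
  case False
  obtain e where "e \<in> E" using nonempty by blast
  then have "6 \<le> card E"
    using card_nbrs[of e] card_mono[OF finite_E, of "nbrs E e"] by (simp add: nbrs_def)
  then show ?thesis using False by (simp add: good_def)
next
  case True
  then obtain U0 W0 where "vsep U0 W0" by blast
  then obtain U W where sep: "vsep U W"
    and min: "\<And>U' W'. vsep U' W' \<Longrightarrow> bdim U \<le> bdim U'"
    by (rule minimal_vsep[where Q = "\<lambda>_. True"]) simp_all
  have good1: "good x" if x: "x \<in> E - W" for x
    unfolding good_def
  proof (intro allI impI notI)
    fix U1 W1 assume sep1: "vsep U1 W1" and x1: "x \<in> U1 \<inter> W1"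
    have "vsep W1 U1" using sep1 by (simp add: vsep_commute)
    then have "bdim U \<le> bdim W1" by (rule min)
    with x x1 min[OF sep1] show False
      by (intro minimal_side_good[OF sep sep1, of x]) (simp_all, rule min)
  qed
  show ?thesis
  proof (cases "card (E - W) < 6")
    case False
    have "E - W \<subseteq> {e \<in> E. good e}" using good1 by blast
    then show ?thesis using False card_mono[of "{e \<in> E. good e}" "E - W"] finite_E by simp
  next
    case True
    have unsplit: "E - W \<subseteq> U1 \<or> E - W \<subseteq> W1" if "vsep U1 W1" for U1 W1
      using good_side_unsplit[OF sep that good1] True by linarith
    \<comment> \<open>A second minimum is taken among the separations with \<open>E - W\<close> in
      the second subspace; \<open>(W, U)\<close> is one of them. The points outside its
      \<open>W2\<close> are disjoint from \<open>E - W\<close> and will turn out to be good.\<close>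
    have "vsep W U" "E - W \<subseteq> U" using sep vsep_commute vsepD(5)[OF sep] by blast+
    then obtain U2 W2 where sep2: "vsep U2 W2" and side: "E - W \<subseteq> W2"
      and min2: "\<And>U' W'. vsep U' W' \<Longrightarrow> E - W \<subseteq> W' \<Longrightarrow> bdim U2 \<le> bdim U'"
      by (rule minimal_vsep[where Q = "\<lambda>W'. E - W \<subseteq> W'"]) (rule that)
    have min2': "bdim U2 \<le> bdim U'" if "vsep U' W'" "W2 \<subseteq> W'" for U' W'
      using min2 that side by blast
    \<comment> \<open>The restricted minimum bounds only \<open>bdim U1\<close>. For
      \<open>bdim W1\<close>, note that \<open>W2 \<inter> W1\<close> contains \<open>0\<close> and
      the at least four points of \<open>E - W\<close>, so its dimension is at least 3. By
      \<open>uncross\<close> this forces \<open>W2 + W1 = V\<close>, and the dimension formula gives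
      \<open>bdim U2 \<le> bdim W1\<close>.\<close>
    have no: False if x: "x \<in> E - W2" and sep1: "vsep U1 W1" "x \<in> U1" "x \<in> W1"
      and W1: "E - W \<subseteq> W1" for x U1 W1
    proof -
      have sp: "bspace (W2 \<inter> W1)" using vsepD[OF sep2] vsepD[OF sep1(1)] by (simp add: bspace_Int)
      have "E - W \<subseteq> W2 \<inter> W1 - {0}" using W1 side zero by blast
      then have "card (E - W) \<le> card (W2 \<inter> W1 - {0})"
        using sp bspace_finite by (intro card_mono) auto
      then have "4 < card (W2 \<inter> W1)"
        using vsep_card_side[OF sep] bspace_0[OF sp] bspace_finite[OF sp]
        by (simp add: card_Diff_singleton)
      then have "(2::nat) ^ 2 < 2 ^ bdim (W2 \<inter> W1)"
        unfolding card_bspace[OF sp] by simp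
      then have dim: "2 < bdim (W2 \<inter> W1)"
        by (rule power_less_imp_less_exp[rotated]) simp
      have sum: "bsum W2 W1 = V"
      proof (rule ccontr)
        assume "bsum W2 W1 \<noteq> V"
        from uncross(1)[OF sep2 sep1(1,3) _ min2' this] x dim show False by simp
      qed
      have "bdim (W2 \<inter> W1) + bdim V = bdim W2 + bdim W1"
        using bdim_bsum[of W2 W1] sum vsepD[OF sep2] vsepD[OF sep1(1)] by simp
      then have "bdim U2 \<le> bdim W1"
        using dim vsepD(8)[OF sep2] by linarith
      moreover have "bdim U2 \<le> bdim U1" using min2 sep1 W1 by blast
      ultimately show False
        using x by (intro minimal_side_good[OF sep2 sep1(1) _ _ sep1(2,3)]) (simp_all, rule min2')
    qed
    have good2: "good x" if "x \<in> E - W2" for x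
      unfolding good_def
    proof (intro allI impI notI)
      fix U1 W1 assume sep1: "vsep U1 W1" "x \<in> U1 \<inter> W1"
      then have "vsep W1 U1" by (simp add: vsep_commute)
      \<comment> \<open>By \<open>unsplit\<close>, one of the two orientations has
        \<open>E - W\<close> in its second subspace.\<close>
      then show False using unsplit[OF sep1(1)] no[OF that] sep1 by blast
    qed
    have "8 \<le> card (E - W) + card (E - W2)"
      using vsep_card_side[OF sep] vsep_card_side[OF sep2] by linarith
    also have "\<dots> = card ((E - W) \<union> (E - W2))"
      using side finite_E by (subst card_Un_disjoint) auto
    also have "\<dots> \<le> card {e \<in> E. good e}"
      using good1 good2 finite_E by (intro card_mono) auto
    finally show ?thesis by simp
  qed
qed

end

section \<open>Rank and contraction\<close>

context matroid
begin

lemma finite_indep: "indep M I \<Longrightarrow> finite I"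
  by (rule finite_subset[OF indep_subset_ground finite_ground])

lemma finite_indeps: "finite {I. I \<subseteq> X \<and> indep M I}"
  by (rule finite_subset[of _ "Pow (ground M)"]) (blast dest: indep_subset_ground, simp add: finite_ground)

lemma card_le_rank: "indep M I \<Longrightarrow> I \<subseteq> X \<Longrightarrow> card I \<le> matroid_rank M X"
  unfolding matroid_rank_def using finite_indeps by (intro Max_ge) auto

lemma rank_attained: "\<exists>I. I \<subseteq> X \<and> indep M I \<and> card I = matroid_rank M X"
proof -
  have "matroid_rank M X \<in> card ` {I. I \<subseteq> X \<and> indep M I}"
    unfolding matroid_rank_def using finite_indeps indep_empty by (intro Max_in) auto
  then show ?thesis by auto
qed

lemma indep_extend:
  assumes "indep M I" "I \<subseteq> X"
  shows "\<exists>J. I \<subseteq> J \<and> J \<subseteq> X \<and> indep M J \<and> card J = matroid_rank M X"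
  using assms
proof (induction "matroid_rank M X - card I" arbitrary: I rule: less_induct)
  case less
  show ?case
  proof (cases "card I = matroid_rank M X")
    case True
    then show ?thesis using less.prems by blast
  next
    case False
    then have lt: "card I < matroid_rank M X"
      using card_le_rank[OF less.prems] by simp
    obtain K where K: "K \<subseteq> X" "indep M K" "card K = matroid_rank M X"
      using rank_attained by blast
    then obtain y where y: "y \<in> K - I" "indep M (insert y I)"
      using augmentation[OF less.prems(1) K(2)] lt by auto
    have "card (insert y I) = Suc (card I)"
      using y finite_indep[OF less.prems(1)] by simp
    then have "matroid_rank M X - card (insert y I) < matroid_rank M X - card I"
      using lt by simp
    moreover have "insert y I \<subseteq> X" using y(1) K(1) less.prems(2) by blast
    ultimately obtain J where "insert y I \<subseteq> J" "J \<subseteq> X" "indep M J" "card J = matroid_rank M X"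
      using less.hyps y(2) by meson
    then show ?thesis by blast
  qed
qed

lemma basis_iff: "basis M B \<longleftrightarrow> indep M B \<and> card B = matroid_rank M (ground M)"
proof
  assume B: "basis M B"
  then have ind: "indep M B" by (simp add: basis_def)
  then obtain J where "B \<subseteq> J" "indep M J" "card J = matroid_rank M (ground M)"
    using indep_extend[OF ind indep_subset_ground[OF ind]] by blast
  then show "indep M B \<and> card B = matroid_rank M (ground M)"
    using B by (auto simp: basis_def)
next
  assume B: "indep M B \<and> card B = matroid_rank M (ground M)"
  have "X = B" if X: "indep M X" "B \<subseteq> X" for X
    using B card_le_rank[OF X(1) indep_subset_ground[OF X(1)]] card_seteq[OF finite_indep[OF X(1)] X(2)]
    by simp
  then show "basis M B" using B by (simp add: basis_def)
qed

lemma ground_contract: "ground (matroid_contract M T) = ground M - T"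
  by (auto simp: matroid_contract_def matroid_dual_def matroid_delete_def matroid_restrict_def)

text \<open>Contraction is defined as the dual of a deletion in the dual, so the bases of that
  deletion come first. If \<open>D\<close> avoids a basis \<open>B\<close> and \<open>e\<close>,
  extending \<open>{e}\<close> inside \<open>insert e B\<close> yields a basis through
  \<open>e\<close> that \<open>D\<close> avoids as well; maximality of \<open>D\<close> does the
  rest.\<close>

lemma basis_delete_dual_iff:
  assumes e: "indep M {e}"
  shows "basis (matroid_delete (matroid_dual M) {e}) D \<longleftrightarrow>
    (\<exists>B. basis M B \<and> e \<in> B \<and> D = ground M - B)"
proof -
  let ?N = "matroid_delete (matroid_dual M) {e}"
  have ind: "indep ?N I \<longleftrightarrow> (\<exists>B. basis M B \<and> I \<subseteq> ground M - B) \<and> e \<notin> I" for I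
    by (auto simp: matroid_delete_def matroid_restrict_def matroid_dual_def)
  have eE: "e \<in> ground M" using indep_subset_ground[OF e] by simp
  show ?thesis
  proof
    assume D: "basis ?N D"
    then have "indep ?N D" by (simp add: basis_def)
    then obtain B where B: "basis M B" "D \<subseteq> ground M - B" "e \<notin> D" using ind by blast
    obtain J where J: "{e} \<subseteq> J" "J \<subseteq> insert e B" "indep M J"
      "card J = matroid_rank M (insert e B)"
      using indep_extend[OF e, of "insert e B"] by blast
    have "matroid_rank M (ground M) \<le> card J"
      using B(1) card_le_rank[of B "insert e B"] J(4) by (auto simp: basis_iff)
    then have bJ: "basis M J"
      using J(3) card_le_rank[OF J(3) indep_subset_ground[OF J(3)]] by (simp add: basis_iff)
    have sub: "D \<subseteq> ground M - J" using B J(2) by blast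
    moreover have "indep ?N (ground M - J)" using ind bJ J(1) by blast
    ultimately have "D = ground M - J" using D by (auto simp: basis_def)
    then show "\<exists>B. basis M B \<and> e \<in> B \<and> D = ground M - B" using bJ J(1) by blast
  next
    assume "\<exists>B. basis M B \<and> e \<in> B \<and> D = ground M - B"
    then obtain B where B: "basis M B" "e \<in> B" "D = ground M - B" by blast
    have "X = D" if X: "indep ?N X" "D \<subseteq> X" for X
    proof -
      obtain B2 where B2: "basis M B2" "X \<subseteq> ground M - B2" using ind X(1) by blast
      have "B2 \<subseteq> ground M" using B2(1) indep_subset_ground[of B2] by (simp add: basis_iff)
      then have "B2 \<subseteq> B" using X(2) B(3) B2(2) by blast
      then have "B2 = B"
        using B(1) B2(1) finite_indep[of B] card_subset_eq[of B B2] by (simp add: basis_iff)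
      then show ?thesis using X(2) B(3) B2(2) by blast
    qed
    moreover have "indep ?N D" using ind B by blast
    ultimately show "basis ?N D" by (simp add: basis_def)
  qed
qed

lemma indep_contract_iff:
  assumes e: "indep M {e}"
  shows "indep (matroid_contract M {e}) I \<longleftrightarrow> e \<notin> I \<and> indep M (insert e I)"
proof -
  have "indep (matroid_contract M {e}) I \<longleftrightarrow>
    (\<exists>D. basis (matroid_delete (matroid_dual M) {e}) D \<and> I \<subseteq> ground M - {e} - D)"
    by (auto simp: matroid_contract_def matroid_dual_def matroid_delete_def matroid_restrict_def)
  also have "\<dots> \<longleftrightarrow> (\<exists>B. basis M B \<and> e \<in> B \<and> I \<subseteq> ground M - {e} - (ground M - B))"
    unfolding basis_delete_dual_iff[OF e] by blast
  also have "\<dots> \<longleftrightarrow> e \<notin> I \<and> indep M (insert e I)"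
  proof
    assume "\<exists>B. basis M B \<and> e \<in> B \<and> I \<subseteq> ground M - {e} - (ground M - B)"
    then obtain B where B: "basis M B" "e \<in> B" "I \<subseteq> B - {e}" by blast
    then have "indep M B" "insert e I \<subseteq> B" by (auto simp: basis_def)
    then show "e \<notin> I \<and> indep M (insert e I)" using indep_mono[of B "insert e I"] B(3) by blast
  next
    assume I: "e \<notin> I \<and> indep M (insert e I)"
    then obtain J where J: "insert e I \<subseteq> J" "indep M J" "card J = matroid_rank M (ground M)"
      using indep_extend[of "insert e I" "ground M"] indep_subset_ground[of "insert e I"] by blast
    then have "basis M J" "J \<subseteq> ground M" using indep_subset_ground[of J] by (auto simp: basis_iff)
    then show "\<exists>B. basis M B \<and> e \<in> B \<and> I \<subseteq> ground M - {e} - (ground M - B)"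
      using J(1) I by (intro exI[of _ J]) auto
  qed
  finally show ?thesis .
qed

text \<open>\<open>N\<close> is given only by its independent sets and is not known to be a matroid,
  so its rank is computed from the definition. A largest independent subset of
  \<open>insert e X\<close> can be taken to contain \<open>e\<close>, and removing \<open>e\<close>
  gives the maximum for \<open>N\<close>.\<close>

lemma rank_contract_restrict:
  assumes e: "indep M {e}" and X: "X \<subseteq> R" "e \<notin> R"
    and N: "\<And>I. indep N I \<longleftrightarrow> I \<subseteq> R \<and> indep M (insert e I)"
  shows "matroid_rank N X + 1 = matroid_rank M (insert e X)"
proof -
  obtain J where J: "{e} \<subseteq> J" "J \<subseteq> insert e X" "indep M J" "card J = matroid_rank M (insert e X)"
    using indep_extend[OF e, of "insert e X"] by blast
  have Jfin: "finite J" using J(3) finite_indep by blast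
  have ins: "insert e (J - {e}) = J" using J(1) by blast
  have "J - {e} \<subseteq> X" using J(2) by blast
  then have J_in: "J - {e} \<in> {I. I \<subseteq> X \<and> indep N I}"
    using X(1) J(3) ins by (auto simp: N)
  have "matroid_rank N X = card (J - {e})"
    unfolding matroid_rank_def
  proof (intro Max_eqI)
    show "finite (card ` {I. I \<subseteq> X \<and> indep N I})"
      using finite_indeps[of "insert e X"]
    proof (intro finite_imageI, elim finite_subset[rotated])
      show "{I. I \<subseteq> X \<and> indep N I} \<subseteq> {I. I \<subseteq> insert e X \<and> indep M I}"
        by (auto simp: N intro: indep_mono[of "insert e _"])
    qed
    show "card (J - {e}) \<in> card ` {I. I \<subseteq> X \<and> indep N I}" using J_in by (rule imageI)
    fix y assume "y \<in> card ` {I. I \<subseteq> X \<and> indep N I}"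
    then obtain I where I: "I \<subseteq> X" "indep M (insert e I)" "y = card I" by (auto simp: N)
    then have "card (insert e I) \<le> card J"
      unfolding J(4) by (intro card_le_rank) auto
    moreover have "e \<notin> I" using I(1) X by blast
    ultimately show "y \<le> card (J - {e})"
      using I finite_indep[OF I(2)] J(1) Jfin by simp
  qed
  then show ?thesis
    using J(1,4) Jfin by (metis Suc_eq_plus1 card_Suc_Diff1 insert_subset)
qed

end

section \<open>Spans as sets of subset sums\<close>

lemma card_le_2_cases:
  assumes "finite J" "card J \<le> 2"
  obtains "J = {}" | a where "J = {a}" | a b where "a \<noteq> b" "J = {a, b}"
proof -
  consider "card J = 0" | "card J = 1" | "card J = 2" using assms(2) by linarith
  then show thesis
    by cases (use assms(1) that card_1_singletonE[of J] card_2_iff[of J] in \<open>auto\<close>)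
qed

text \<open>Over GF(2) the coefficients of a linear combination are 0 and 1, so for finite
  \<open>X\<close> the subset sums form the span of the family \<open>v\<close> on
  \<open>X\<close>.\<close>

definition bspan :: "('a \<Rightarrow> 'i \<Rightarrow> bit) \<Rightarrow> 'a set \<Rightarrow> ('i \<Rightarrow> bit) set" where
  "bspan v X = sum v ` Pow X"

lemma bspan_insert:
  assumes "finite X" "x \<notin> X"
  shows "bspan v (insert x X) = bspan v X \<union> (+) (v x) ` bspan v X"
proof -
  have "sum v (insert x J) = v x + sum v J" if "J \<subseteq> X" for J
    using that assms finite_subset by (subst sum.insert) auto
  then show ?thesis
    unfolding bspan_def Pow_insert image_Un image_image by (simp cong: image_cong_simp)
qed

lemma bspace_bspan: "finite X \<Longrightarrow> bspace (bspan v X)"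
proof (induction X rule: finite_induct)
  case empty
  show ?case by (simp add: bspan_def bspace_def)
next
  case (insert x X)
  then show ?case using bspace_adjoin by (simp add: bspan_insert)
qed

lemma bspan_mono: "X \<subseteq> Y \<Longrightarrow> bspan v X \<subseteq> bspan v Y"
  by (auto simp: bspan_def)

lemma bspan_superset: "x \<in> X \<Longrightarrow> v x \<in> bspan v X"
  unfolding bspan_def by (rule image_eqI[of _ _ "{x}"]) auto

lemma bspan_least:
  assumes "bspace S" "v ` X \<subseteq> S"
  shows "bspan v X \<subseteq> S"
proof -
  have "finite J \<Longrightarrow> J \<subseteq> X \<Longrightarrow> sum v J \<in> S" for J
    by (induction J rule: finite_induct) (use assms in \<open>auto intro: bspace_0 bspace_add\<close>)
  \<comment> \<open>\<open>X\<close> may be infinite; a sum over an infinite set has default value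
    0.\<close>
  moreover have "sum v J \<in> S" if "infinite J" for J
    using that assms bspace_0 by simp
  ultimately show ?thesis unfolding bspan_def by blast
qed

lemma sum_add_sum_bitvec:
  fixes v :: "'a \<Rightarrow> 'i \<Rightarrow> bit"
  assumes "finite A" "finite B"
  shows "sum v A + sum v B = sum v ((A - B) \<union> (B - A))"
proof -
  have "sum v A = sum v (A \<inter> B) + sum v (A - B)" "sum v B = sum v (A \<inter> B) + sum v (B - A)"
    using sum.Int_Diff[OF assms(1), of v B] sum.Int_Diff[OF assms(2), of v A] by (simp_all add: Int_commute)
  then have "sum v A + sum v B = sum v (A \<inter> B) + (sum v (A \<inter> B) + (sum v (A - B) + sum v (B - A)))"
    by (simp only: add.assoc add.left_commute[of "sum v (A - B)" "sum v (A \<inter> B)"])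
  also have "\<dots> = sum v (A - B) + sum v (B - A)" by (rule bitvec_add_cancel)
  also have "\<dots> = sum v ((A - B) \<union> (B - A))"
    using assms by (intro sum.union_disjoint[symmetric]) auto
  finally show ?thesis .
qed

text \<open>A family is linearly independent over GF(2) when no nonempty finite subfamily sums to 0.
  Sums are indexed by elements, so parallel elements may share a vector.\<close>

locale bit_represented_matroid = matroid M for M :: "'a matroid" +
  fixes v :: "'a \<Rightarrow> 'i \<Rightarrow> bit"
  assumes indep_iff: "I \<subseteq> ground M \<Longrightarrow>
    indep M I \<longleftrightarrow> (\<forall>J\<subseteq>I. sum v J = 0 \<longrightarrow> J = {})"
begin

abbreviation points :: "('i \<Rightarrow> bit) set" where
  "points \<equiv> v ` ground M"

abbreviation space :: "('i \<Rightarrow> bit) set" where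
  "space \<equiv> bspan v (ground M)"

text \<open>Different subsets of a maximal independent set \<open>J\<close> have different sums,
  because their symmetric difference would otherwise sum to 0. Any further \<open>x\<close>
  completes a subset summing to 0, which expresses \<open>v x\<close> through
  \<open>J\<close>.\<close>

lemma bdim_bspan:
  assumes X: "X \<subseteq> ground M"
  shows "bdim (bspan v X) = matroid_rank M X"
proof -
  obtain J where J: "J \<subseteq> X" "indep M J" "card J = matroid_rank M X"
    using rank_attained by blast
  have fin: "finite J" "finite X" using J finite_indep X finite_ground finite_subset by blast+
  have "inj_on (sum v) (Pow J)"
  proof (rule inj_onI)
    fix A B assume AB: "A \<in> Pow J" "B \<in> Pow J" and eq: "sum v A = sum v B"
    have "finite A" "finite B" using AB fin finite_subset by auto
    then have "sum v ((A - B) \<union> (B - A)) = 0"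
      using sum_add_sum_bitvec[of A B v] eq by simp
    moreover have "(A - B) \<union> (B - A) \<subseteq> J" using AB by blast
    ultimately have "(A - B) \<union> (B - A) = {}"
      using indep_iff[of J] J X by blast
    then show "A = B" by blast
  qed
  then have "card (bspan v J) = 2 ^ matroid_rank M X"
    using fin J(3) by (simp add: bspan_def card_image card_Pow)
  moreover have "bspan v J = bspan v X"
  proof
    show "bspan v J \<subseteq> bspan v X" using J by (intro bspan_mono)
    have "v x \<in> bspan v J" if x: "x \<in> X" for x
    proof (cases "x \<in> J")
      case True
      then show ?thesis by (rule bspan_superset)
    next
      case False
      have "\<not> indep M (insert x J)"
      proof
        assume "indep M (insert x J)"
        then have "card (insert x J) \<le> card J" unfolding J(3) using x J(1) by (intro card_le_rank) auto
        then show False using False fin by simp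
      qed
      moreover have "insert x J \<subseteq> ground M" using x J X by blast
      ultimately obtain K where K: "K \<subseteq> insert x J" "sum v K = 0" "K \<noteq> {}"
        using indep_iff[of "insert x J"] by blast
      have "x \<in> K"
      proof (rule ccontr)
        assume "x \<notin> K"
        then have "K \<subseteq> J" using K by blast
        then show False using indep_iff[of J] J X K by blast
      qed
      moreover have "finite K" using K fin finite_subset by blast
      ultimately have "v x + sum v (K - {x}) = 0"
        using K(2) sum.remove[of K x v] by simp
      then have "v x = sum v (K - {x})" by (simp add: bitvec_add_eq_0_iff)
      moreover have "K - {x} \<in> Pow J" using K by blast
      ultimately show ?thesis unfolding bspan_def by blast
    qed
    then show "bspan v X \<subseteq> bspan v J"
      using fin by (intro bspan_least bspace_bspan) auto
  qed
  ultimately show ?thesis by (intro bdimI) simp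
qed

end

locale simple_bit_represented_matroid = bit_represented_matroid +
  assumes inj: "inj_on v (ground M)" and zero_notin: "0 \<notin> v ` ground M"
begin

lemma small_sum_nonzero:
  assumes "J \<subseteq> ground M" "card J \<le> 2" "sum v J = 0"
  shows "J = {}"
proof -
  have fin: "finite J" using assms finite_ground finite_subset by blast
  then show ?thesis
    using assms inj zero_notin
    by (cases rule: card_le_2_cases[OF fin assms(2)])
      (auto simp: bitvec_add_eq_0_iff image_iff dest: inj_onD)
qed

lemma indep_small:
  assumes "J \<subseteq> ground M" "card J \<le> 2"
  shows "indep M J"
  unfolding indep_iff[OF assms(1)]
proof (intro allI impI)
  fix K assume K: "K \<subseteq> J" "sum v K = 0"
  have "finite J" using assms(1) finite_ground finite_subset by blast
  then have "card K \<le> 2" using card_mono[OF _ K(1)] assms(2) by linarith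
  then show "K = {}" using small_sum_nonzero K assms(1) by blast
qed

lemma triangle_iff: "triangle M T \<longleftrightarrow> T \<subseteq> ground M \<and> card T = 3 \<and> sum v T = 0"
proof
  assume "triangle M T"
  then have T: "T \<subseteq> ground M" "\<not> indep M T" "\<And>X. X \<subset> T \<Longrightarrow> indep M X" "card T = 3"
    by (auto simp: triangle_def circuit_def)
  then obtain J where J: "J \<subseteq> T" "sum v J = 0" "J \<noteq> {}" using indep_iff[OF T(1)] by blast
  have "J = T"
  proof (rule ccontr)
    assume "J \<noteq> T"
    then have "indep M J" using T(3) J by blast
    then show False using indep_iff[of J] J T(1) by blast
  qed
  then show "T \<subseteq> ground M \<and> card T = 3 \<and> sum v T = 0" using T J by simp
next
  assume T: "T \<subseteq> ground M \<and> card T = 3 \<and> sum v T = 0"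
  then have "\<not> indep M T" using indep_iff[of T] by fastforce
  moreover have "indep M X" if "X \<subset> T" for X
  proof (rule indep_small)
    have "finite T" using T finite_ground finite_subset by blast
    then show "card X \<le> 2" using psubset_card_mono[OF _ that] T by simp
  qed (use T that in blast)
  ultimately show "triangle M T" using T by (simp add: triangle_def circuit_def)
qed

end

section \<open>Simplified contractions\<close>

lemma quotient_representatives:
  assumes "equiv A r"
  defines "R \<equiv> (\<lambda>P. SOME e. e \<in> P) ` (A // r)"
  shows "R \<subseteq> A" "\<And>a. a \<in> A \<Longrightarrow> \<exists>b\<in>R. (a, b) \<in> r" "\<And>a b. a \<in> R \<Longrightarrow> b \<in> R \<Longrightarrow> (a, b) \<in> r \<Longrightarrow> a = b"
proof -
  have some: "(SOME e. e \<in> P) \<in> P" if "P \<in> A // r" for P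
    using in_quotient_imp_non_empty[OF assms(1) that] by (simp add: some_in_eq)
  show "R \<subseteq> A"
    unfolding R_def using some in_quotient_imp_subset[OF assms(1)] by blast
  show "\<exists>b\<in>R. (a, b) \<in> r" if "a \<in> A" for a
  proof
    have cls: "r `` {a} \<in> A // r" using that by (rule quotientI)
    show "(a, SOME e. e \<in> r `` {a}) \<in> r" using some[OF cls] by blast
    show "(SOME e. e \<in> r `` {a}) \<in> R" unfolding R_def using cls by (rule imageI)
  qed
  show "a = b" if ab: "a \<in> R" "b \<in> R" "(a, b) \<in> r" for a b
  proof -
    obtain P Q where P: "P \<in> A // r" "a = (SOME e. e \<in> P)" and Q: "Q \<in> A // r" "b = (SOME e. e \<in> Q)"
      using ab(1,2) by (auto simp: R_def)
    have "P = Q"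
      using some[OF P(1)] some[OF Q(1)] ab(3) unfolding P(2) Q(2)
      by (rule quotient_eqI[OF assms(1) P(1) Q(1)])
    then show ?thesis using P Q by simp
  qed
qed

lemma sum_insert3:
  fixes v :: "'a \<Rightarrow> 'i \<Rightarrow> bit"
  assumes "e \<notin> {a, b}" "a \<notin> {b}"
  shows "sum v {e, a, b} = v e + (v a + v b)"
  using assms by simp

context simple_bit_represented_matroid
begin

lemma finite_subset_ground: "X \<subseteq> ground M \<Longrightarrow> finite X"
  using finite_ground finite_subset by blast

lemma v_nonzero: "a \<in> ground M \<Longrightarrow> v a \<noteq> 0"
  using zero_notin by (metis imageI)

lemma v_eq_iff: "a \<in> ground M \<Longrightarrow> b \<in> ground M \<Longrightarrow> v a = v b \<longleftrightarrow> a = b"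
  using inj by (simp add: inj_on_eq_iff)

lemma dependent_iff_sum_0:
  assumes "T \<subseteq> ground M" "card T = 3"
  shows "\<not> indep M T \<longleftrightarrow> sum v T = 0"
proof -
  have "indep M X" if X: "X \<subset> T" for X
  proof (rule indep_small)
    show "card X \<le> 2"
      using psubset_card_mono[OF finite_subset_ground[OF assms(1)] X] assms(2) by simp
  qed (use X assms in blast)
  then have "triangle M T \<longleftrightarrow> \<not> indep M T"
    using assms by (simp add: triangle_def circuit_def)
  then show ?thesis using triangle_iff assms by blast
qed

text \<open>Equality modulo \<open>{0, v e}\<close>, that is, equality of the images in the quotient
  that represents the contraction.\<close>

definition twin :: "'a \<Rightarrow> 'a \<Rightarrow> 'a \<Rightarrow> bool" where
  "twin e a b \<longleftrightarrow> v a = v b \<or> v a = v e + v b"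

lemma parallel_contract_iff:
  assumes e: "e \<in> ground M"
  shows "(a, b) \<in> parallel_rel (matroid_contract M {e}) \<longleftrightarrow>
    a \<in> ground M - {e} \<and> b \<in> ground M - {e} \<and> twin e a b"
proof -
  let ?C = "matroid_contract M {e}"
  have ind_e: "indep M {e}" using indep_small e by simp
  note ind = indep_contract_iff[OF ind_e]
  have single: "indep ?C {a}" if "a \<in> ground M - {e}" for a
    unfolding ind using that e by (auto intro!: indep_small)
  have empty: "indep ?C {}" unfolding ind using ind_e by simp
  have nl: "nonloops ?C = ground M - {e}"
    using single by (auto simp: nonloops_def ground_contract circuit_def)
  have "circuit ?C {a, b} \<longleftrightarrow> v a = v e + v b"
    if ab: "a \<in> ground M - {e}" "b \<in> ground M - {e}" "a \<noteq> b" for a b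
  proof -
    have proper: "indep ?C X" if "X \<subset> {a, b}" for X
    proof -
      have "X = {} \<or> X = {a} \<or> X = {b}" using that by blast
      then show ?thesis using single ab empty by blast
    qed
    have "circuit ?C {a, b} \<longleftrightarrow> \<not> indep M {e, a, b}"
      using proper ab ind by (auto simp: circuit_def ground_contract)
    also have "\<dots> \<longleftrightarrow> sum v {e, a, b} = 0"
      using ab e by (intro dependent_iff_sum_0) auto
    also have "sum v {e, a, b} = v e + (v a + v b)"
    proof -
      have "e \<notin> {a, b}" "a \<notin> {b}" using ab by auto
      then show ?thesis by (rule sum_insert3)
    qed
    also have "\<dots> = 0 \<longleftrightarrow> v a = v e + v b"
      by (metis add.commute bitvec_add_eq_0_iff bitvec_add_eq_iff)
    finally show ?thesis .
  qed
  then show ?thesis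
    unfolding parallel_rel_def nl twin_def by (auto simp: v_eq_iff)
qed

lemma equiv_parallel_contract:
  assumes e: "e \<in> ground M"
  shows "equiv (ground M - {e}) (parallel_rel (matroid_contract M {e}))"
proof (rule equivI)
  note iff = parallel_contract_iff[OF e]
  show "parallel_rel (matroid_contract M {e}) \<subseteq> (ground M - {e}) \<times> (ground M - {e})"
    using iff by auto
  show "refl_on (ground M - {e}) (parallel_rel (matroid_contract M {e}))"
    using iff by (auto simp: refl_on_def twin_def)
  show "sym (parallel_rel (matroid_contract M {e}))"
    by (rule symI) (auto simp: iff twin_def)
  show "trans (parallel_rel (matroid_contract M {e}))"
    by (rule transI) (auto simp: iff twin_def)
qed

lemma simplification_contract:
  assumes e: "e \<in> ground M"
  defines "N \<equiv> simplification (matroid_contract M {e})"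
  shows "ground N \<subseteq> ground M - {e}"
    "\<And>a. a \<in> ground M - {e} \<Longrightarrow> \<exists>b\<in>ground N. twin e a b"
    "\<And>a b. a \<in> ground N \<Longrightarrow> b \<in> ground N \<Longrightarrow> twin e a b \<Longrightarrow> a = b"
    "\<And>I. indep N I \<longleftrightarrow> I \<subseteq> ground N \<and> indep M (insert e I)"
proof -
  let ?C = "matroid_contract M {e}"
  let ?R = "(\<lambda>P. SOME e. e \<in> P) ` ((ground M - {e}) // parallel_rel ?C)"
  have ind_e: "indep M {e}" using indep_small e by simp
  have "nonloops ?C = ground M - {e}"
  proof -
    have "a \<in> nonloops ?C \<longleftrightarrow> (a, a) \<in> parallel_rel ?C" for a
      by (auto simp: parallel_rel_def)
    then show ?thesis using parallel_contract_iff[OF e] by (auto simp: twin_def)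
  qed
  then have N: "N = matroid_restrict ?C ?R"
    by (simp add: N_def simplification_def parallel_classes_def)
  note R = quotient_representatives[OF equiv_parallel_contract[OF e]]
  have ground: "ground N = ?R"
    using R(1) by (auto simp: N matroid_restrict_def ground_contract)
  show "ground N \<subseteq> ground M - {e}" using R(1) ground by simp
  show "\<exists>b\<in>ground N. twin e a b" if "a \<in> ground M - {e}" for a
    using R(2)[OF that] parallel_contract_iff[OF e] ground by auto
  show "a = b" if "a \<in> ground N" "b \<in> ground N" "twin e a b" for a b
  proof -
    have "a \<in> ?R" "b \<in> ?R" using that ground by simp_all
    moreover have "(a, b) \<in> parallel_rel ?C"
      unfolding parallel_contract_iff[OF e] using that R(1) ground by blast
    ultimately show ?thesis by (rule R(3))
  qed
  show "indep N I \<longleftrightarrow> I \<subseteq> ground N \<and> indep M (insert e I)" for I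
  proof -
    have "e \<notin> I" if "I \<subseteq> ?R" using that R(1) by blast
    then show ?thesis
      unfolding ground using indep_contract_iff[OF ind_e, of I]
      by (auto simp: N matroid_restrict_def)
  qed
qed

lemma points_subset_space: "points \<subseteq> space"
  by (rule image_subsetI, rule bspan_superset)

lemma space_subset_iff: "bspace S \<Longrightarrow> space \<subseteq> S \<longleftrightarrow> points \<subseteq> S"
  using bspan_least[of S v "ground M"] points_subset_space by blast

lemma bspace_space: "bspace space"
  using finite_ground by (rule bspace_bspan)

end

section \<open>Connectivity of simplified contractions\<close>

locale four_connected_points = simple_bit_represented_matroid M v + three_triangle_points "v ` ground M" "bspan v (ground M)"
  for M :: "'a matroid" and v :: "'a \<Rightarrow> 'i \<Rightarrow> bit"
begin

text \<open>The sides are lifted to the spans \<open>?U\<close> and \<open>?W\<close> of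
  \<open>insert e X\<close> and \<open>insert e Y\<close>, whose dimensions exceed the ranks in
  \<open>N\<close> by one. If neither contains all points, \<open>conn\<close> makes them a
  \<open>vsep\<close> pair through \<open>v e\<close>, against goodness. Otherwise one is the whole
  space, the other has dimension at most \<open>k\<close>, and a count shows that its side is a
  triangle.\<close>

lemma simplification_contract_separation:
  fixes e
  defines "N \<equiv> simplification (matroid_contract M {e})"
  assumes e: "e \<in> ground M" "good (v e)" and sep: "matroid_separation N k X Y" and k: "k \<le> 3"
  shows "k = 3 \<and> (triangle N X \<or> triangle N Y)"
proof -
  note N = simplification_contract[OF e(1), folded N_def]
  have s: "1 \<le> k" "X \<union> Y = ground N" "X \<inter> Y = {}" "connectivity N X \<le> int k - 1"
    "k \<le> card X" "k \<le> card Y"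
    using sep by (auto simp: matroid_separation_def)
  have sub: "insert e X \<subseteq> ground M" "insert e Y \<subseteq> ground M" "e \<notin> ground N"
    using s(2) N(1) e by auto
  have ind_e: "indep M {e}" using indep_small e by simp
  let ?U = "bspan v (insert e X)" and ?W = "bspan v (insert e Y)"
  have sp: "bspace ?U" "bspace ?W" using sub finite_subset_ground bspace_bspan by blast+
  have UW: "?U \<subseteq> space" "?W \<subseteq> space" using sub by (simp_all add: bspan_mono)
  have e_in: "v e \<in> ?U" "v e \<in> ?W" by (simp_all add: bspan_superset)
  \<comment> \<open>A deleted element has a twin in \<open>N\<close>, and a span containing
    \<open>v e\<close> and one of two twins contains the other.\<close>
  have cover: "v a \<in> ?U \<union> ?W" if a: "a \<in> ground M" for a
  proof (cases "a = e")
    case True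
    then show ?thesis using e_in by simp
  next
    case False
    then obtain b where b: "b \<in> ground N" "twin e a b" using N(2) a by blast
    then have "v b \<in> ?U \<or> v b \<in> ?W" using s(2) bspan_superset[of b "insert e _" v] by blast
    then show ?thesis
      using b(2) e_in sp by (auto simp: twin_def intro: bspace_add)
  qed
  have rank: "matroid_rank N Z + 1 = bdim (bspan v (insert e Z))" if "Z \<subseteq> ground N" for Z
  proof -
    have "insert e Z \<subseteq> ground M" using that N(1) e by blast
    then show ?thesis
      using rank_contract_restrict[OF ind_e that sub(3) N(4)] bdim_bspan by simp
  qed
  have "bspan v (insert e (ground N)) = space"
  proof
    show "bspan v (insert e (ground N)) \<subseteq> space" using N(1) e by (intro bspan_mono) auto
    have "?U \<subseteq> bspan v (insert e (ground N))" "?W \<subseteq> bspan v (insert e (ground N))"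
      using s(2) by (auto intro!: bspan_mono)
    then have "points \<subseteq> bspan v (insert e (ground N))" using cover by blast
    moreover have "bspace (bspan v (insert e (ground N)))"
      using N(1) e by (intro bspace_bspan finite_subset_ground) auto
    ultimately show "space \<subseteq> bspan v (insert e (ground N))" by (simp add: space_subset_iff)
  qed
  then have rN: "matroid_rank N (ground N) + 1 = bdim space"
    using rank[of "ground N"] by simp
  have "ground N - X = Y" using s(2,3) by blast
  then have "int (matroid_rank N X) + int (matroid_rank N Y) - int (matroid_rank N (ground N)) \<le> int k - 1"
    using s(4) by (simp add: connectivity_def)
  moreover have "matroid_rank N X + 1 = bdim ?U" "matroid_rank N Y + 1 = bdim ?W"
    using rank[of X] rank[of Y] s(2) by blast+
  ultimately have dims: "bdim ?U + bdim ?W \<le> bdim space + k"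
    using s(1) rN by linarith
  \<comment> \<open>The span of \<open>insert e Z\<close> contains \<open>0\<close>,
    \<open>v e\<close>, and both \<open>v z\<close> and \<open>v e + v z\<close> for every
    \<open>z\<close> in \<open>Z\<close>, all distinct because no two elements of \<open>N\<close>
    are twins. Thus \<open>2 + 2 * card Z \<le> 2 ^ k\<close> while \<open>k \<le> card Z\<close>,
    which excludes k = 1 and k = 2 and leaves \<open>card Z = 3\<close>.\<close>
  have triangle: "k = 3 \<and> triangle N Z"
    if Z: "Z \<subseteq> ground N" "k \<le> card Z" "bdim (bspan v (insert e Z)) \<le> k" for Z
  proof -
    let ?S = "bspan v (insert e Z)"
    have Zsub: "insert e Z \<subseteq> ground M" using Z(1) N(1) e by blast
    then have "finite (insert e Z)" by (rule finite_subset_ground)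
    then have Zfin: "finite Z" and spS: "bspace ?S" using bspace_bspan[of "insert e Z" v] by simp_all
    have in_S: "v z \<in> ?S" if "z \<in> insert e Z" for z using that by (rule bspan_superset)
    have inj1: "inj_on v (insert e Z)" using inj Zsub inj_on_subset by blast
    have inj2: "inj_on (\<lambda>z. v e + v z) Z"
      using inj1 by (auto simp: inj_on_def)
    have disj: "v z \<noteq> v e + v y" if "z \<in> Z" "y \<in> Z" for z y
    proof
      assume eq: "v z = v e + v y"
      then have "z = y" using N(3)[of z y] that Z(1) by (auto simp: twin_def)
      then have "v e + v y = v y" using eq by simp
      then have "v e = 0" by simp
      then show False using v_nonzero e by blast
    qed
    have "card (insert 0 (v ` insert e Z \<union> (\<lambda>z. v e + v z) ` Z)) = 2 + 2 * card Z"
    proof -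
      have eZ: "e \<notin> Z" using sub(3) Z(1) by blast
      have "v e \<noteq> v e + v z" "v e + v z \<noteq> 0" if "z \<in> Z" for z
        using v_nonzero[of z] v_eq_iff[of e z] that Zsub eZ by (auto simp: bitvec_add_eq_0_iff)
      then have "v ` insert e Z \<inter> (\<lambda>z. v e + v z) ` Z = {}"
        using disj by blast
      then have "card (v ` insert e Z \<union> (\<lambda>z. v e + v z) ` Z) = card (insert e Z) + card Z"
        using Zfin inj1 inj2 by (simp only: card_Un_disjoint finite_imageI finite_insert card_image)
      moreover have "0 \<notin> v ` insert e Z \<union> (\<lambda>z. v e + v z) ` Z"
        using v_nonzero Zsub \<open>\<And>z. z \<in> Z \<Longrightarrow> v e + v z \<noteq> 0\<close> by force
      ultimately show ?thesis using Zfin eZ by simp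
    qed
    moreover have "insert 0 (v ` insert e Z \<union> (\<lambda>z. v e + v z) ` Z) \<subseteq> ?S"
      using spS in_S bspace_0 by (auto intro: bspace_add)
    ultimately have "2 + 2 * card Z \<le> 2 ^ bdim ?S"
      using card_mono[OF bspace_finite[OF spS]] card_bspace[OF spS] by metis
    also have "\<dots> \<le> 2 ^ k" using Z(3) by (intro power_increasing) auto
    finally have le: "2 + 2 * card Z \<le> 2 ^ k" .
    consider "k = 1" | "k = 2" | "k = 3" using s(1) k by linarith
    then have k3: "k = 3" and Z3: "card Z = 3"
      by (cases; use le Z(2) in simp)+
    have "\<not> indep N Z"
    proof
      assume "indep N Z"
      then have "indep M (insert e Z)" using N(4) by blast
      then have "card (insert e Z) \<le> bdim ?S"
        using card_le_rank[of "insert e Z" "insert e Z"] bdim_bspan[OF Zsub] by simp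
      moreover have "e \<notin> Z" using sub(3) Z(1) by blast
      ultimately show False using Z(3) k3 Z3 Zfin by simp
    qed
    moreover have "indep N X'" if X': "X' \<subset> Z" for X'
    proof -
      have card_X': "card X' \<le> 2" using psubset_card_mono[OF Zfin X'] Z3 by simp
      have X'sub: "insert e X' \<subseteq> ground M" using X' Zsub by blast
      have "indep M (insert e X')"
        unfolding indep_iff[OF X'sub]
      proof (intro allI impI, rule ccontr)
        fix J assume J: "J \<subseteq> insert e X'" "sum v J = 0" "J \<noteq> {}"
        have fin: "finite J" using J X'sub finite_subset_ground by blast
        have "\<not> card J \<le> 2"
          using small_sum_nonzero[of J] J X'sub by blast
        moreover have "card (J - {e}) \<le> card X'"
          using J(1) X' Zfin finite_subset by (intro card_mono) auto
        ultimately have "e \<in> J" and J2: "card (J - {e}) = 2"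
          using card_X' fin by (auto simp: card_Diff_singleton_if split: if_splits)
        \<comment> \<open>A zero sum of \<open>v e\<close>, \<open>v a\<close> and
          \<open>v b\<close> would make the two representatives \<open>a\<close> and
          \<open>b\<close> twins.\<close>
        obtain a b where ab: "J - {e} = {a, b}" "a \<noteq> b" using J2 unfolding card_2_iff by blast
        then have "v e + (v a + v b) = 0"
          using J(2) \<open>e \<in> J\<close> fin sum.remove[of J e v] by simp
        then have "v e = v a + v b" by (simp only: bitvec_add_eq_0_iff)
        then have "v b = v a + v e" by (simp add: bitvec_add_eq_iff)
        then have "twin e b a" by (simp add: twin_def add.commute)
        moreover have "a \<in> Z" "b \<in> Z" using ab J(1) X' by blast+
        ultimately show False using N(3) Z(1) ab(2) by blast
      qed
      then show ?thesis using N(4) X' Z(1) by blast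
    qed
    ultimately show ?thesis using k3 Z3 Z(1) by (simp add: triangle_def circuit_def)
  qed
  show ?thesis
  proof (cases "points \<subseteq> ?U \<or> points \<subseteq> ?W")
    case True
    then show ?thesis
    proof
      assume "points \<subseteq> ?U"
      then have "bdim space \<le> bdim ?U"
        using space_subset_iff sp bspace_space by (intro bdim_mono) auto
      then show ?thesis using triangle[of Y] dims s(2,6) by auto
    next
      assume "points \<subseteq> ?W"
      then have "bdim space \<le> bdim ?W"
        using space_subset_iff sp bspace_space by (intro bdim_mono) auto
      then show ?thesis using triangle[of X] dims s(2,5) by auto
    qed
  next
    case False
    have cov: "points \<subseteq> ?U \<union> ?W" using cover by blast
    then have "bdim space + 3 \<le> bdim ?U + bdim ?W"
      using conn sp UW False by blast
    then have "vsep ?U ?W" using dims k sp UW False cov by (simp add: vsep_def)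
    then show ?thesis using e(2) e_in by (auto simp: good_def)
  qed
qed

lemma good_imp_internally_4_connected:
  assumes "e \<in> ground M" "good (v e)"
  shows "internally_4_connected (simplification (matroid_contract M {e}))"
  unfolding internally_4_connected_def matroid_connected_def
  using simplification_contract_separation[OF assms] by fastforce

end

section \<open>Binary matroids as point sets\<close>

lemma sum_fun_apply: "(sum f A :: 'i \<Rightarrow> bit) i = (\<Sum>x\<in>A. f x i)"
  by (induction A rule: infinite_finite_induct) simp_all

text \<open>Padding with zeros makes vanishing of the vector the same as vanishing in the first
  \<open>m\<close> rows.\<close>

definition columns :: "nat \<Rightarrow> (nat \<Rightarrow> 'a \<Rightarrow> bit) \<Rightarrow> 'a \<Rightarrow> nat \<Rightarrow> bit" where
  "columns m A x = (\<lambda>i. if i < m then A i x else 0)"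

text \<open>A coefficient function with values in \<open>bit\<close> is the indicator of its
  support, so quantifying over coefficients amounts to quantifying over subsets.\<close>

lemma represents_columns:
  assumes rep: "represents m A M" and I: "I \<subseteq> ground M" "finite I"
  shows "indep M I \<longleftrightarrow> (\<forall>J\<subseteq>I. sum (columns m A) J = 0 \<longrightarrow> J = {})"
proof -
  have comb: "(\<Sum>x\<in>I. c x * A i x) = sum (columns m A) {x \<in> I. c x \<noteq> 0} i"
    if "i < m" for c :: "'a \<Rightarrow> bit" and i
  proof -
    have "(\<Sum>x\<in>I. c x * A i x) = (\<Sum>x\<in>I. if c x \<noteq> 0 then A i x else 0)"
      by (intro sum.cong) auto
    also have "\<dots> = (\<Sum>x | x \<in> I \<and> c x \<noteq> 0. A i x)"
      using I(2) by (simp add: sum.inter_filter)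
    finally show ?thesis using that by (simp add: sum_fun_apply columns_def)
  qed
  have zero: "(\<forall>i<m. (\<Sum>x\<in>I. c x * A i x) = 0) \<longleftrightarrow> sum (columns m A) {x \<in> I. c x \<noteq> 0} = 0"
    for c :: "'a \<Rightarrow> bit"
  proof
    assume "\<forall>i<m. (\<Sum>x\<in>I. c x * A i x) = 0"
    then have "sum (columns m A) {x \<in> I. c x \<noteq> 0} i = 0" for i
      using comb[of i c] by (cases "i < m") (simp_all add: sum_fun_apply columns_def)
    then show "sum (columns m A) {x \<in> I. c x \<noteq> 0} = 0" by (simp add: fun_eq_iff)
  next
    assume "sum (columns m A) {x \<in> I. c x \<noteq> 0} = 0"
    then show "\<forall>i<m. (\<Sum>x\<in>I. c x * A i x) = 0" using comb[of _ c] by simp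
  qed
  have "indep M I \<longleftrightarrow>
      (\<forall>c :: 'a \<Rightarrow> bit. (\<forall>i<m. (\<Sum>x\<in>I. c x * A i x) = 0) \<longrightarrow> (\<forall>x\<in>I. c x = 0))"
    by (rule mp[OF spec[where x = I, OF rep[unfolded represents_def]] I(1)])
  also have "\<dots> \<longleftrightarrow> (\<forall>c :: 'a \<Rightarrow> bit. sum (columns m A) {x \<in> I. c x \<noteq> 0} = 0 \<longrightarrow> (\<forall>x\<in>I. c x = 0))"
    by (rule all_cong1) (rule imp_cong[OF zero refl])
  also have "\<dots> \<longleftrightarrow> (\<forall>J\<subseteq>I. sum (columns m A) J = 0 \<longrightarrow> J = {})"
  proof (intro iffI allI impI)
    fix J assume *: "\<forall>c :: 'a \<Rightarrow> bit. sum (columns m A) {x \<in> I. c x \<noteq> 0} = 0 \<longrightarrow> (\<forall>x\<in>I. c x = 0)"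
      and J: "J \<subseteq> I" "sum (columns m A) J = 0"
    define c :: "'a \<Rightarrow> bit" where "c x = (if x \<in> J then 1 else 0)" for x
    have "{x \<in> I. c x \<noteq> 0} = J" using J(1) by (auto simp: c_def)
    then have "sum (columns m A) {x \<in> I. c x \<noteq> 0} = 0" using J(2) by simp
    then have "\<forall>x\<in>I. c x = 0" by (rule mp[OF spec[OF *]])
    then show "J = {}" using J(1) by (auto simp: c_def split: if_splits)
  next
    fix c :: "'a \<Rightarrow> bit"
    assume "\<forall>J\<subseteq>I. sum (columns m A) J = 0 \<longrightarrow> J = {}" "sum (columns m A) {x \<in> I. c x \<noteq> 0} = 0"
    then have "{x \<in> I. c x \<noteq> 0} = {}" by (elim allE[of _ "{x \<in> I. c x \<noteq> 0}"]) simp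
    then show "\<forall>x\<in>I. c x = 0" by blast
  qed
  finally show ?thesis .
qed

context bit_represented_matroid
begin

text \<open>A loop would be a dependent proper subset of a triangle. A parallel pair has rank at
  most 1 and would form a 2-separation with its complement.\<close>

lemma simpleI:
  assumes conn: "matroid_connected 3 M"
    and tri: "\<forall>e\<in>ground M. card {T. triangle M T \<and> e \<in> T} = 3"
  shows "simple_bit_represented_matroid M v"
proof
  have in_triangle: "\<exists>T. triangle M T \<and> e \<in> T" if e: "e \<in> ground M" for e
  proof (rule ccontr)
    assume "\<not> ?thesis"
    then have "{T. triangle M T \<and> e \<in> T} = {}" by blast
    then have "card {T. triangle M T \<and> e \<in> T} = 0" by (simp only: card.empty)
    then show False using bspec[OF tri e] by linarith
  qed
  have nonzero: "v e \<noteq> 0" if e: "e \<in> ground M" for e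
  proof
    assume "v e = 0"
    then have "\<not> indep M {e}"
      using indep_iff[of "{e}"] e by (auto intro!: exI[of _ "{e}"])
    moreover obtain T where "triangle M T" "e \<in> T" using in_triangle[OF e] by blast
    then have "{e} \<subset> T" "\<And>X. X \<subset> T \<Longrightarrow> indep M X"
      by (auto simp: triangle_def circuit_def)
    ultimately show False by blast
  qed
  then show "0 \<notin> points" by force
  show "inj_on v (ground M)"
  proof (rule inj_onI, rule ccontr)
    fix a b assume ab: "a \<in> ground M" "b \<in> ground M" "v a = v b" "a \<noteq> b"
    have "bspan v {a, b} \<subseteq> bspan v {a}"
      using ab(3) bspan_superset[of a "{a}" v] by (intro bspan_least bspace_bspan) auto
    then have "bdim (bspan v {a, b}) \<le> bdim (bspan v {a})"
      by (intro bdim_mono bspace_bspan) auto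
    then have "matroid_rank M {a, b} \<le> matroid_rank M {a}"
      using ab(1,2) by (simp add: bdim_bspan)
    moreover obtain I where I: "I \<subseteq> {a}" "card I = matroid_rank M {a}"
      using rank_attained[of "{a}"] by blast
    then have "matroid_rank M {a} \<le> 1" using card_mono[OF _ I(1)] by simp
    moreover have "matroid_rank M (ground M - {a, b}) \<le> matroid_rank M (ground M)"
    proof -
      obtain I where "I \<subseteq> ground M - {a, b}" "indep M I" "card I = matroid_rank M (ground M - {a, b})"
        using rank_attained[of "ground M - {a, b}"] by blast
      then show ?thesis using card_le_rank[of I "ground M"] by auto
    qed
    ultimately have "connectivity M {a, b} \<le> int 2 - 1"
      by (simp add: connectivity_def)
    \<comment> \<open>In a ground set of at most three elements the only possible triangle is the
      ground set itself, against three triangles at \<open>a\<close>.\<close>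
    moreover have "2 \<le> card (ground M - {a, b})"
    proof (rule ccontr)
      assume "\<not> ?thesis"
      then have "card (ground M) \<le> 3"
        using ab finite_ground by (simp add: card_Diff_subset)
      then have "T = ground M" if "triangle M T" for T
        using that finite_ground by (intro card_seteq) (auto simp: triangle_def circuit_def)
      then have "{T. triangle M T \<and> a \<in> T} \<subseteq> {ground M}" by blast
      then have "card {T. triangle M T \<and> a \<in> T} \<le> 1"
        using card_mono[of "{ground M}"] by fastforce
      then show False using tri ab(1) by simp
    qed
    ultimately have "matroid_separation M 2 {a, b} (ground M - {a, b})"
      using ab by (auto simp: matroid_separation_def)
    moreover have "(2::nat) < 3" by simp
    ultimately show False using conn unfolding matroid_connected_def by blast
  qed
qed

end

section \<open>Triangles and separations in terms of points\<close>

context simple_bit_represented_matroid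
begin

lemma triangle_insert_iff:
  assumes "e \<in> ground M" "a \<in> ground M" "b \<in> ground M" "v e + v a = v b"
  shows "triangle M {e, a, b}"
proof -
  have "e \<noteq> a" using assms v_nonzero by auto
  moreover have "a \<noteq> b" using assms v_nonzero[of e] by auto
  moreover have "e \<noteq> b" using assms v_nonzero[of a] by auto
  ultimately have "e \<notin> {a, b}" "a \<notin> {b}" by auto
  then have "sum v {e, a, b} = v e + (v a + v b)" by (rule sum_insert3)
  also have "\<dots> = v b + v b" using assms(4) by (simp only: add.assoc[symmetric])
  finally have "sum v {e, a, b} = 0" by simp
  then show ?thesis
    using assms \<open>e \<notin> {a, b}\<close> \<open>a \<notin> {b}\<close> by (simp add: triangle_iff)
qed

lemma triangle_elements:
  assumes "triangle M T" "e \<in> T" "a \<in> T" "a \<noteq> e"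
  obtains b where "T = {e, a, b}" "b \<in> ground M" "b \<noteq> e" "a \<noteq> b" "v b = v e + v a"
proof -
  have T: "T \<subseteq> ground M" "card T = 3" "sum v T = 0" using assms(1) triangle_iff by auto
  have "finite T" using T(1) by (rule finite_subset_ground)
  then have "card (T - {e, a}) = 1" using T(2) assms by (simp add: card_Diff_subset)
  then obtain b where b: "T - {e, a} = {b}" by (auto simp: card_1_singleton_iff)
  then have Teq: "T = {e, a, b}" and ne: "e \<notin> {a, b}" "a \<notin> {b}" using assms by auto
  have "(v e + v a) + v b = 0"
    using T(3) sum_insert3[OF ne, of v] Teq by (simp add: add.assoc)
  then have "v b = v e + v a" using bitvec_add_eq_0_iff by metis
  then show thesis using that[of b] Teq ne T(1) by blast
qed

text \<open>Two points of a triangle determine the third, so distinct triangles through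
  \<open>e\<close> meet only in \<open>e\<close>, and each contributes its two other points.\<close>

lemma card_nbrs_points:
  assumes e: "e \<in> ground M"
  shows "card (nbrs points (v e)) = 2 * card {T. triangle M T \<and> e \<in> T}"
proof -
  let ?TT = "{T. triangle M T \<and> e \<in> T}"
  have fin: "finite ?TT"
    by (rule finite_subset[of _ "Pow (ground M)"]) (auto simp: triangle_iff finite_ground)
  have nbrs_eq: "nbrs points (v e) = v ` (\<Union>T\<in>?TT. T - {e})"
  proof (intro equalityI subsetI)
    fix x assume "x \<in> nbrs points (v e)"
    then obtain a b where ab: "a \<in> ground M" "x = v a" "b \<in> ground M" "v e + v a = v b"
      by (auto simp: nbrs_def)
    have "a \<noteq> e" using ab v_nonzero[of b] by auto
    then show "x \<in> v ` (\<Union>T\<in>?TT. T - {e})"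
      using triangle_insert_iff[OF e ab(1,3,4)] ab(2) by blast
  next
    fix x assume "x \<in> v ` (\<Union>T\<in>?TT. T - {e})"
    then obtain T a where T: "triangle M T" "e \<in> T" "a \<in> T" "a \<noteq> e" "x = v a" by blast
    then obtain b where "b \<in> ground M" "v b = v e + v a" using triangle_elements[of T e a] by blast
    moreover have "a \<in> ground M" using T triangle_iff by blast
    ultimately show "x \<in> nbrs points (v e)"
      using imageI[of b "ground M" v] T(5) by (simp add: nbrs_def)
  qed
  have "card (\<Union>T\<in>?TT. T - {e}) = (\<Sum>T\<in>?TT. card (T - {e}))"
  proof (rule card_UN_disjoint)
    show "\<forall>T\<in>?TT. finite (T - {e})" using finite_subset_ground triangle_iff by auto
    show "\<forall>T\<in>?TT. \<forall>T'\<in>?TT. T \<noteq> T' \<longrightarrow> (T - {e}) \<inter> (T' - {e}) = {}"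
    proof (intro ballI impI, rule ccontr)
      fix T T' assume T: "T \<in> ?TT" "T' \<in> ?TT" "T \<noteq> T'" "(T - {e}) \<inter> (T' - {e}) \<noteq> {}"
      then obtain a where a: "a \<in> T" "a \<in> T'" "a \<noteq> e" by blast
      obtain b where b: "T = {e, a, b}" "b \<in> ground M" "v b = v e + v a"
        using triangle_elements[of T e a] T(1) a by blast
      obtain c where c: "T' = {e, a, c}" "c \<in> ground M" "v c = v e + v a"
        using triangle_elements[of T' e a] T(2) a by blast
      have "b = c" using b c v_eq_iff by metis
      then show False using b c T(3) by simp
    qed
  qed (rule fin)
  also have "\<dots> = (\<Sum>T\<in>?TT. 2)"
    by (intro sum.cong) (auto simp: triangle_iff)
  finally have "card (\<Union>T\<in>?TT. T - {e}) = 2 * card ?TT" by simp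
  moreover have "inj_on v (\<Union>T\<in>?TT. T - {e})"
    by (rule inj_on_subset[OF inj]) (auto simp: triangle_iff)
  ultimately show ?thesis by (simp add: nbrs_eq card_image)
qed

text \<open>The cover is turned into the partition of the ground set by membership in
  \<open>U\<close>. Both parts have at least four elements, since the points outside
  \<open>W\<close> lie in \<open>U\<close>. So neither is a triangle or triad, and a violation of
  \<open>conn\<close> would be a forbidden 3-separation.\<close>

lemma four_connected_pointsI:
  assumes nonempty: "ground M \<noteq> {}" and i4c: "internally_4_connected M"
    and tri: "\<forall>e\<in>ground M. card {T. triangle M T \<and> e \<in> T} = 3"
  shows "four_connected_points M v"
proof unfold_locales
  show "bspace space" by (rule bspace_space)
  show "points \<subseteq> space" by (rule points_subset_space)
  show "space \<subseteq> S" if "bspace S" "points \<subseteq> S" for S using that space_subset_iff by blast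
  show "0 \<notin> points" by (rule zero_notin)
  show "points \<noteq> {}" using nonempty by simp
  show nbrs6: "card (nbrs points x) = 6" if "x \<in> points" for x
    using that card_nbrs_points tri by auto
  fix U W assume sp: "bspace U" "bspace W" "U \<subseteq> space" "W \<subseteq> space"
    and cover: "points \<subseteq> U \<union> W" and proper: "\<not> points \<subseteq> U" "\<not> points \<subseteq> W"
  have four: "4 \<le> card (points - S)" if S: "bspace S" "\<not> points \<subseteq> S" for S
  proof -
    obtain x where "x \<in> points" "x \<notin> S" using S(2) by blast
    then show ?thesis
      using card_outside_bspace_ge_4[of points S x] S(1) nbrs6 finite_ground zero_notin by blast
  qed
  let ?X = "{x \<in> ground M. v x \<in> U}"
  let ?Y = "ground M - ?X"
  have "card (points - W) \<le> card (v ` ?X)"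
    using cover finite_ground by (intro card_mono) auto
  also have "\<dots> \<le> card ?X" using finite_ground by (intro card_image_le) simp
  finally have X4: "4 \<le> card ?X" using four[OF sp(2) proper(2)] by linarith
  have "card (points - U) \<le> card (v ` ?Y)"
    using finite_ground by (intro card_mono) auto
  also have "\<dots> \<le> card ?Y" using finite_ground by (intro card_image_le) simp
  finally have Y4: "4 \<le> card ?Y" using four[OF sp(1) proper(1)] by linarith
  have rank_le: "matroid_rank M Z \<le> bdim S" if "Z \<subseteq> ground M" "bspace S" "v ` Z \<subseteq> S" for Z S
  proof -
    have "bdim (bspan v Z) \<le> bdim S"
      using that by (intro bdim_mono bspace_bspan finite_subset_ground bspan_least)
    then show ?thesis using bdim_bspan that(1) by simp
  qed
  have rX: "matroid_rank M ?X \<le> bdim U" using sp(1) by (intro rank_le) auto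
  have rY: "matroid_rank M ?Y \<le> bdim W" using sp(2) cover by (intro rank_le) auto
  show "bdim space + 3 \<le> bdim U + bdim W"
  proof (rule ccontr)
    assume small: "\<not> ?thesis"
    have "bdim space = matroid_rank M (ground M)" by (rule bdim_bspan) simp
    then have "connectivity M ?X \<le> int 3 - 1"
      unfolding connectivity_def using rX rY small by linarith
    then have "matroid_separation M 3 ?X ?Y"
      using X4 Y4 by (auto simp: matroid_separation_def)
    then have "triangle M ?X \<or> triad M ?X \<or> triangle M ?Y \<or> triad M ?Y"
      using i4c unfolding internally_4_connected_def by blast
    then have "card ?X = 3 \<or> card ?Y = 3" unfolding triangle_def triad_def by blast
    then show False using X4 Y4 by linarith
  qed
qed

end

lemma six_le_card_internally_4_connected_contractions:
  assumes M: "matroid M" "binary_matroid M" "ground M \<noteq> {}" "internally_4_connected M"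
    and tri: "\<forall>e\<in>ground M. card {T. triangle M T \<and> e \<in> T} = 3"
  shows "6 \<le> card {e \<in> ground M. internally_4_connected (simplification (matroid_contract M {e}))}"
    (is "6 \<le> card ?S")
proof -
  interpret matroid M by (rule M(1))
  obtain m and A :: "nat \<Rightarrow> 'a \<Rightarrow> bit" where rep: "represents m A M"
    using M(2) by (auto simp: binary_matroid_def representable_def)
  let ?v = "columns m A"
  interpret bit_represented_matroid M ?v
    by unfold_locales (rule represents_columns[OF rep], auto intro: finite_subset[OF _ finite_ground])
  interpret simple_bit_represented_matroid M ?v
    by (rule simpleI[OF _ tri]) (use M(4) in \<open>simp add: internally_4_connected_def\<close>)
  interpret four_connected_points M ?v
    by (rule four_connected_pointsI[OF M(3,4) tri])
  have "{p \<in> ?v ` ground M. good p} \<subseteq> ?v ` ?S"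
    using good_imp_internally_4_connected by auto
  then have "card {p \<in> ?v ` ground M. good p} \<le> card (?v ` ?S)"
    using finite_ground by (intro card_mono) auto
  also have "\<dots> \<le> card ?S" using finite_ground by (intro card_image_le) simp
  finally show ?thesis using six_le_card_good by linarith
qed

theorem theorem1p1:
  fixes M :: "'a matroid"
  assumes "matroid M"
    and "ground M \<noteq> {}"
    and "binary_matroid M"
    and "internally_4_connected M"
    and "\<forall>e\<in>ground M. card {T. triangle M T \<and> e \<in> T} = 3"
  defines "S \<equiv> {e \<in> ground M. internally_4_connected (simplification (matroid_contract M {e}))}"
  shows "4 \<le> card S \<and> (card S < 6 \<longrightarrow> (\<exists>C. cocircuit M C \<and> card C = 4 \<and> S \<subseteq> C))"
  using six_le_card_internally_4_connected_contractions[OF assms(1,3,2,4,5)]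
  unfolding S_def by simp

end
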